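(* Let $n\geq 2$ be an integer. If $C$ is a critical set of minimal size in the Latin square $L(3^n)$, then $$|C| \geq 24\cdot 9^{\,n-2}.$$
   Context: A Latin square $L$ of order $N$ is an $N\times N$ array, with rows and columns indexed by $\{0,\dots,N-1\}$, such that each row and each column contains each of the $N$ elements $0,\dots,N-1$ exactly once. It is identified with the set of its entries $(i,j;k)$, meaning that the cell in row $i$ and column $j$ contains $k$. A subset $C\subseteq L$ is uniquely completable (to $L$) if $L$ is the only Latin square of order $N$ (on the same rows, columns and elements) that contains $C$. A critical set of $L$ (or in $L$) is a subset $C\subseteq L$ that is uniquely completable to $L$ and such that no proper subset of $C$ is uniquely completable to $L$. A critical set of minimal size in $L$ is a critical set of $L$ of smallest cardinality among all critical sets of $L$. $L(3^n)$ is the Latin square of order $3^n$ given by the Cayley table of the elementary abelian 3-group $(\mathbb{Z}/3)^n$; explicitly, identify each integer in $\{0,\dots,3^n-1\}$ with its vector of $n$ base-3 digits in $(\mathbb{Z}/3)^n$; the entry in row $i$ and column $j$ is the integer whose digit vector is the sum in $(\mathbb{Z}/3)^n$ of those of $i$ and $j$. *)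

theory Defs
  imports Main
begin

text \<open>An array is represented by its set of entries; \<open>(i, j, k)\<close> says that the cell in row
  \<open>i\<close> and column \<open>j\<close> contains \<open>k\<close>. The three conditions after the range condition say: each
  cell is filled exactly once, each row contains each element exactly once, and each column
  contains each element exactly once.\<close>

definition latin_square :: "nat \<Rightarrow> (nat \<times> nat \<times> nat) set \<Rightarrow> bool" where
  "latin_square N L \<longleftrightarrow>
     L \<subseteq> {..<N} \<times> {..<N} \<times> {..<N} \<and>
     (\<forall>i<N. \<forall>j<N. \<exists>!k. (i, j, k) \<in> L) \<and>
     (\<forall>i<N. \<forall>k<N. \<exists>!j. (i, j, k) \<in> L) \<and>
     (\<forall>j<N. \<forall>k<N. \<exists>!i. (i, j, k) \<in> L)"

definition uniquely_completable ::
  "nat \<Rightarrow> (nat \<times> nat \<times> nat) set \<Rightarrow> (nat \<times> nat \<times> nat) set \<Rightarrow> bool" where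
  "uniquely_completable N L C \<longleftrightarrow> C \<subseteq> L \<and> {M. latin_square N M \<and> C \<subseteq> M} = {L}"

definition critical_set ::
  "nat \<Rightarrow> (nat \<times> nat \<times> nat) set \<Rightarrow> (nat \<times> nat \<times> nat) set \<Rightarrow> bool" where
  "critical_set N L C \<longleftrightarrow>
     uniquely_completable N L C \<and> (\<forall>D. D \<subset> C \<longrightarrow> \<not> uniquely_completable N L D)"

definition minimal_size_critical_set ::
  "nat \<Rightarrow> (nat \<times> nat \<times> nat) set \<Rightarrow> (nat \<times> nat \<times> nat) set \<Rightarrow> bool" where
  "minimal_size_critical_set N L C \<longleftrightarrow>
     critical_set N L C \<and> (\<forall>D. critical_set N L D \<longrightarrow> card C \<le> card D)"

definition digit3 :: "nat \<Rightarrow> nat \<Rightarrow> nat" where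
  "digit3 d x = x div 3 ^ d mod 3"

text \<open>Cayley table of \<open>(\<int>/3)\<^sup>n\<close>, a number below \<open>3 ^ n\<close> standing for its vector of \<open>n\<close>
  base-3 digits.\<close>

definition L3 :: "nat \<Rightarrow> (nat \<times> nat \<times> nat) set" where
  "L3 n = {(i, j, k). i < 3 ^ n \<and> j < 3 ^ n \<and> k < 3 ^ n \<and>
     (\<forall>d<n. digit3 d k = (digit3 d i + digit3 d j) mod 3)}"

end

theory Submission
  imports Defs "HOL-Library.Product_Plus"
begin

text \<open>
  Let \<open>V = (\<int>/3)\<^sup>2\<close>. Writing row, column and element numbers as \<open>9 * a + r\<close> with \<open>r < 9\<close> cuts
  \<open>L3 n\<close> into \<open>9 ^ (n - 2)\<close> blocks, each a copy of the Cayley table of \<open>V\<close>. So it suffices that a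
  uniquely completable set \<open>C\<close> has at least 24 entries in every block (\<open>block_hit\<close>,
  \<open>hitting_set_size\<close>). All that is used about \<open>C\<close> is that it meets every trade of six entries formed by
  two parallel lines of a \<open>3 \<times> 3\<close> subsquare, because the two lines could otherwise be exchanged.
  The cells of a block form \<open>V \<times> V\<close>, the subsquares are the planes \<open>{i + s v} \<times> {j + t v}\<close>, and the
  condition says that the set \<open>X\<close> of cells used by \<open>C\<close> misses at most one of the three rows, at most one
  of the three columns and at most one of the three elements of every plane (\<open>hit\<close>).

  Suppose that such an \<open>X\<close> has only 23 cells. The sum of the squared sizes of all lines of all
  36 planes is computed in two ways. Two cells in a common row of the block lie in exactly one
  line, so the lines inside one row with \<open>c\<close> cells contribute \<open>c\<^sup>2 + 3 c\<close>; the same holds for columns and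
  elements. On the other hand, a plane with \<open>c \<le> 5\<close> cells contributes at most \<open>9 c - 12\<close>, and at least 2
  less unless it is slim, that is, misses a row, a column and an element. Since nine
  integers with sum 23 have square sum at least 61, and the three square sums turn out to be
  at most 189 in total (\<open>square_sum_upper\<close>), there is almost no room: in the best of the three
  classes every row has two or three cells and at most three planes are not slim, or a single row is
  exceptional and at most one plane is not slim (\<open>profile\<close>). Planes with more than five cells are kept under
  control by \<open>square_sum_lower\<close>, as they make the row counts uneven.

  A counting argument then gives a row with exactly two cells whose plane is slim and whose
  partner row has exactly three cells (\<open>no_hitting_set_of_23\<close>). An affine change of coordinates moves this
  configuration to one of three normal forms (\<open>anchored_move\<close>). In each of them the planes split into four
  parts, or into two parts if nothing is known about the other rows, such that the planes
  of one part cannot all be slim (the \<open>region\<close> lemmas). This contradicts the bound on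
  the number of planes that are not slim.
\<close>

section \<open>The plane over the field with three elements\<close>

datatype trit = T0 | T1 | T2

instantiation trit :: comm_ring_1
begin
definition "0 = T0"
definition "1 = T1"
fun plus_trit :: "trit \<Rightarrow> trit \<Rightarrow> trit" where
  "T0 + x = x" | "x + T0 = x" | "T1 + T1 = T2" | "T1 + T2 = T0" | "T2 + T1 = T0" | "T2 + T2 = T1"
fun uminus_trit :: "trit \<Rightarrow> trit" where
  "- T0 = T0" | "- T1 = T2" | "- T2 = T1"
definition "x - y = x + (- y)" for x y :: trit
fun times_trit :: "trit \<Rightarrow> trit \<Rightarrow> trit" where
  "T0 * x = T0" | "T1 * x = x" | "T2 * x = - x"
instance
proof
  fix a b c :: trit
  show "a + b + c = a + (b + c)" by (cases a; cases b; cases c) auto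
  show "a + b = b + a" by (cases a; cases b) auto
  show "0 + a = a" by (cases a) (auto simp: zero_trit_def)
  show "- a + a = 0" by (cases a) (auto simp: zero_trit_def)
  show "a - b = a + - b" by (simp add: minus_trit_def)
  show "a * b * c = a * (b * c)" by (cases a; cases b; cases c) auto
  show "a * b = b * a" by (cases a; cases b) auto
  show "1 * a = a" by (cases a) (auto simp: one_trit_def)
  show "(a + b) * c = a * c + b * c" by (cases a; cases b; cases c) auto
  show "(0::trit) \<noteq> 1" by (simp add: zero_trit_def one_trit_def)
qed
end

type_synonym vec = "trit \<times> trit"

text \<open>The simplifier turns \<open>x + - y\<close> into \<open>x - y\<close>, so unfolding the definition of subtraction would loop; a
  table is used instead.\<close>

lemma minus_trit_simps:
  "x - T0 = x" "T0 - T1 = T2" "T0 - T2 = T1" "T1 - T1 = T0" "T1 - T2 = T2" "T2 - T1 = T1" "T2 - T2 = T0"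
  for x :: trit
  by (cases x; simp only: minus_trit_def uminus_trit.simps plus_trit.simps)+

lemmas trit_simps = zero_trit_def one_trit_def minus_trit_simps zero_prod_def plus_prod_def minus_prod_def uminus_prod_def

text \<open>The three clauses say that \<open>X\<close> meets the union of two parallel row lines, column lines or element
  lines of a plane with direction \<open>v\<close>; as \<open>i\<close>, \<open>j\<close> and the sign of \<open>v\<close> vary, every pair of parallel
  lines occurs.\<close>

definition hit :: "(vec \<Rightarrow> vec \<Rightarrow> bool) \<Rightarrow> bool" where
  "hit X \<longleftrightarrow> (\<forall>v i j. v \<noteq> 0 \<longrightarrow>
     (X i j \<or> X i (j+v) \<or> X i (j-v) \<or> X (i+v) j \<or> X (i+v) (j+v) \<or> X (i+v) (j-v)) \<and>
     (X i j \<or> X (i+v) j \<or> X (i-v) j \<or> X i (j+v) \<or> X (i+v) (j+v) \<or> X (i-v) (j+v)) \<and>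
     (X i j \<or> X (i+v) (j-v) \<or> X (i-v) (j+v) \<or> X i (j+v) \<or> X (i+v) j \<or> X (i-v) (j-v)))"

lemma hit_row: "hit X \<Longrightarrow> v \<noteq> 0 \<Longrightarrow>
     X i j \<or> X i (j+v) \<or> X i (j-v) \<or> X (i+v) j \<or> X (i+v) (j+v) \<or> X (i+v) (j-v)"
  and hit_col: "hit X \<Longrightarrow> v \<noteq> 0 \<Longrightarrow>
     X i j \<or> X (i+v) j \<or> X (i-v) j \<or> X i (j+v) \<or> X (i+v) (j+v) \<or> X (i-v) (j+v)"
  and hit_sym: "hit X \<Longrightarrow> v \<noteq> 0 \<Longrightarrow>
     X i j \<or> X (i+v) (j-v) \<or> X (i-v) (j+v) \<or> X i (j+v) \<or> X (i+v) j \<or> X (i-v) (j-v)"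
  unfolding hit_def by blast+

abbreviation "v00 \<equiv> (T0, T0)"
abbreviation "v01 \<equiv> (T0, T1)"
abbreviation "v02 \<equiv> (T0, T2)"
abbreviation "v10 \<equiv> (T1, T0)"
abbreviation "v11 \<equiv> (T1, T1)"
abbreviation "v12 \<equiv> (T1, T2)"
abbreviation "v20 \<equiv> (T2, T0)"
abbreviation "v21 \<equiv> (T2, T1)"
abbreviation "v22 \<equiv> (T2, T2)"

definition smul :: "trit \<Rightarrow> vec \<Rightarrow> vec" (infixr "\<odot>" 75) where
  "t \<odot> x = (t * fst x, t * snd x)"

lemma UNIV_trit: "(UNIV :: trit set) = {T0, T1, T2}"
  using trit.exhaust by auto

instance trit :: finite
  by standard (simp add: UNIV_trit)

lemma sum_trit: "(\<Sum>t\<in>UNIV. f t) = f T0 + f T1 + f T2"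
  for f :: "trit \<Rightarrow> 'a :: comm_monoid_add"
  by (simp add: UNIV_trit add.assoc)

lemma all_trit: "(\<forall>t. P t) \<longleftrightarrow> P T0 \<and> P T1 \<and> P T2"
  by (metis trit.exhaust)

lemma ex_trit: "(\<exists>t. P t) \<longleftrightarrow> P T0 \<or> P T1 \<or> P T2"
  by (metis trit.exhaust)

lemma sum_vec: "(\<Sum>x\<in>UNIV. f x) = (\<Sum>s\<in>UNIV. \<Sum>t\<in>UNIV. f (s, t))"
  for f :: "vec \<Rightarrow> 'a :: comm_monoid_add"
  by (simp add: UNIV_Times_UNIV[symmetric] sum.cartesian_product del: UNIV_Times_UNIV)

text \<open>A pair \<open>(v, u)\<close> consists of one of the four directions of \<open>V\<close> and a complementary vector \<open>u\<close>: the multiples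
  of \<open>u\<close> are representatives of the three lines with direction \<open>v\<close>.\<close>

definition frames :: "(vec \<times> vec) list" where
  "frames = [(v01, v10), (v10, v01), (v11, v01), (v12, v01)]"

text \<open>Any two points of the affine plane \<open>V\<close> lie on exactly one of its 12 lines, and each point lies on
  four of them.\<close>

lemma line_sum_squares:
  fixes f :: "vec \<Rightarrow> int"
  shows "(\<Sum>(v, u)\<leftarrow>frames. \<Sum>s\<in>UNIV. (\<Sum>a\<in>UNIV. f (s \<odot> u + a \<odot> v))\<^sup>2)
    = 3 * (\<Sum>x\<in>UNIV. (f x)\<^sup>2) + (\<Sum>x\<in>UNIV. f x)\<^sup>2"
  by (simp add: frames_def sum_trit sum_vec smul_def trit_simps power2_eq_square algebra_simps)

lemma frame_sum:
  fixes f :: "vec \<Rightarrow> 'a :: comm_monoid_add"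
  assumes "(v, u) \<in> set frames"
  shows "(\<Sum>s\<in>UNIV. \<Sum>a\<in>UNIV. f (s \<odot> u + a \<odot> v)) = (\<Sum>x\<in>UNIV. f x)"
  using assms by (auto simp add: frames_def sum_trit sum_vec smul_def trit_simps ac_simps)

text \<open>A pattern \<open>p\<close> describes the cells chosen in one plane; its element lines are \<open>{(b, a - b)}\<close> for fixed \<open>a\<close>.\<close>

definition hits :: "(trit \<Rightarrow> trit \<Rightarrow> bool) \<Rightarrow> bool" where
  "hits p \<longleftrightarrow> (\<forall>a c. a \<noteq> c \<longrightarrow>
     (\<exists>b. p a b \<or> p c b) \<and> (\<exists>b. p b a \<or> p b c) \<and> (\<exists>b. p b (a - b) \<or> p b (c - b)))"

definition slim :: "(trit \<Rightarrow> trit \<Rightarrow> bool) \<Rightarrow> bool" where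
  "slim p \<longleftrightarrow>
     (\<exists>a. \<forall>b. \<not> p a b) \<and> (\<exists>a. \<forall>b. \<not> p b a) \<and> (\<exists>a. \<forall>b. \<not> p b (a - b))"

definition size3 :: "(trit \<Rightarrow> trit \<Rightarrow> bool) \<Rightarrow> int" where
  "size3 p = (\<Sum>a\<in>UNIV. \<Sum>b\<in>UNIV. of_bool (p a b))"

text \<open>The sum of the squared sizes of the nine lines of a plane, three for each of the classes rows,
  columns and elements.\<close>

definition energy :: "(trit \<Rightarrow> trit \<Rightarrow> bool) \<Rightarrow> int" where
  "energy p = (\<Sum>a\<in>UNIV. (\<Sum>b\<in>UNIV. of_bool (p a b))\<^sup>2)
     + (\<Sum>a\<in>UNIV. (\<Sum>b\<in>UNIV. of_bool (p b a))\<^sup>2)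
     + (\<Sum>a\<in>UNIV. (\<Sum>b\<in>UNIV. of_bool (p b (a - b)))\<^sup>2)"

definition surplus :: "int \<Rightarrow> int" where "surplus c = max 0 (c - 5)"

text \<open>In a direction that misses one line, sizes such as \<open>1, 1, 0\<close> or \<open>2, 1, 0\<close> occur, in a direction that meets all
  three lines the sizes are more balanced and the squares smaller. Exact equality holds for the
  slim patterns, which are pairs of cells that share no line and triangles of three cells that
  share one line of each class. The summand with \<open>surplus\<close> makes the bound valid for six and
  seven cells too. There are \<open>2 ^ 9\<close> patterns, and all are checked.\<close>

lemma plane_inequality:
  "hits p \<Longrightarrow> 2 \<le> size3 p \<and> (slim p \<longrightarrow> size3 p \<le> 3) \<and>
    (size3 p \<le> 7 \<longrightarrow>
      energy p + 2 * of_bool (\<not> slim p) \<le> 9 * size3 p - 12 + 2 * surplus (size3 p))"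
  unfolding hits_def slim_def size3_def energy_def surplus_def all_trit ex_trit sum_trit
  unfolding minus_trit_simps
  by (cases "p T0 T0"; cases "p T0 T1"; cases "p T0 T2"; cases "p T1 T0"; cases "p T1 T1"; cases "p T1 T2";
      cases "p T2 T0"; cases "p T2 T1"; cases "p T2 T2"; simp)

section \<open>Squared line sizes, counted by planes and by classes\<close>

definition plane :: "(vec \<Rightarrow> vec \<Rightarrow> bool) \<Rightarrow> vec \<Rightarrow> vec \<Rightarrow> trit \<Rightarrow> trit \<Rightarrow> trit \<Rightarrow> trit \<Rightarrow> bool" where
  "plane X v u s t a b = X (s \<odot> u + a \<odot> v) (t \<odot> u + b \<odot> v)"

lemma smul_simps [simp]: "T0 \<odot> v = 0" "T1 \<odot> v = v" "T2 \<odot> v = - v"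
  by (cases v; simp add: smul_def trit_simps)+

lemma vec_triple: "v + v = - v" "x + v + v = x - v" "x - v - v = x + v" for x v :: vec
proof -
  have *: "w + w = - w" for w :: trit by (cases w; simp only: plus_trit.simps uminus_trit.simps)
  show 1: "v + v = - v" by (simp only: plus_prod_def uminus_prod_def *)
  show "x + v + v = x - v" by (simp only: add.assoc 1 add_uminus_conv_diff)
  show "x - v - v = x + v" by (simp only: diff_diff_add 1 diff_minus_eq_add)
qed

lemma smul_diff: "(s - t) \<odot> u = s \<odot> u - t \<odot> u"
  by (cases u) (simp add: smul_def left_diff_distrib)

lemma smul_add: "(s + t) \<odot> u = s \<odot> u + t \<odot> u"
  by (cases u) (simp add: smul_def distrib_right)

lemma frame_nonzero: "(v, u) \<in> set frames \<Longrightarrow> v \<noteq> 0"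
  by (auto simp: frames_def trit_simps)

text \<open>The pairs of lines with indices \<open>0, 1\<close> and \<open>1, 2\<close> and \<open>2, 0\<close> of a plane are the pairs in the definition of
  \<open>hit\<close> for three consecutive base points.\<close>

lemma hits_translate:
  assumes H: "hit X" and v: "v \<noteq> 0"
  shows "hits (\<lambda>a b. X (i + a \<odot> v) (j + b \<odot> v))"
proof -
  note r = hit_row[OF H v] note c = hit_col[OF H v] note s = hit_sym[OF H v]
  have rr: "(\<exists>b. X (i + a \<odot> v) (j + b \<odot> v) \<or> X (i + c \<odot> v) (j + b \<odot> v))" if "a \<noteq> c" for a c
    using that r[of i j] r[of "i + v" j] r[of "i - v" j]
    by (cases a; cases c; simp add: ex_trit vec_triple; blast)
  have cc: "(\<exists>b. X (i + b \<odot> v) (j + a \<odot> v) \<or> X (i + b \<odot> v) (j + c \<odot> v))" if "a \<noteq> c" for a c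
    using that c[of i j] c[of i "j + v"] c[of i "j - v"]
    by (cases a; cases c; simp add: ex_trit vec_triple; blast)
  have ss: "(\<exists>b. X (i + b \<odot> v) (j + (a - b) \<odot> v) \<or> X (i + b \<odot> v) (j + (c - b) \<odot> v))" if "a \<noteq> c" for a c
    using that s[of i j] s[of i "j + v"] s[of i "j - v"]
    by (cases a; cases c; simp add: ex_trit vec_triple minus_trit_simps zero_trit_def; blast)
  show ?thesis unfolding hits_def using rr cc ss by blast
qed

lemma hits_plane: "hit X \<Longrightarrow> (v, u) \<in> set frames \<Longrightarrow> hits (plane X v u s t)"
  unfolding plane_def by (rule hits_translate) (auto dest: frame_nonzero)

definition rowc where "rowc X i = (\<Sum>j\<in>UNIV. of_bool (X i j) :: int)" for X :: "vec \<Rightarrow> vec \<Rightarrow> bool"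
definition colc where "colc X j = (\<Sum>i\<in>UNIV. of_bool (X i j) :: int)" for X :: "vec \<Rightarrow> vec \<Rightarrow> bool"
definition symc where "symc X k = (\<Sum>i\<in>UNIV. of_bool (X i (k - i)) :: int)" for X :: "vec \<Rightarrow> vec \<Rightarrow> bool"
definition cell_count where "cell_count X = (\<Sum>i\<in>UNIV. rowc X i)"
definition sqsum where "sqsum f = (\<Sum>i\<in>UNIV. (f i)\<^sup>2 :: int)" for f :: "vec \<Rightarrow> int"

lemma cell_count_col: "(\<Sum>j\<in>UNIV. colc X j) = cell_count X"
  unfolding cell_count_def rowc_def colc_def by (rule sum.swap)

lemma sum_shift: "(\<Sum>x\<in>UNIV. f (x - c)) = (\<Sum>x\<in>UNIV. f x)"
  for f :: "'a :: {finite, ab_group_add} \<Rightarrow> 'b :: comm_monoid_add"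
  by (rule sum.reindex_bij_witness[of _ "\<lambda>x. x + c" "\<lambda>x. x - c"]) auto

lemma cell_count_sym: "(\<Sum>k\<in>UNIV. symc X k) = cell_count X"
proof -
  have "(\<Sum>k\<in>UNIV. symc X k) = (\<Sum>i\<in>UNIV. \<Sum>k\<in>UNIV. of_bool (X i (k - i)))"
    unfolding symc_def by (rule sum.swap)
  also have "\<dots> = cell_count X"
    unfolding cell_count_def rowc_def using sum_shift[of "\<lambda>j. of_bool (X i j) :: int" i for i] by simp
  finally show ?thesis .
qed

lemma size_plane: "size3 (plane X v u s t) = (\<Sum>a\<in>UNIV. \<Sum>b\<in>UNIV. of_bool (X (s \<odot> u + a \<odot> v) (t \<odot> u + b \<odot> v)))"
  by (simp add: size3_def plane_def)

text \<open>The three rows \<open>s u + a v\<close> are the union of three planes with direction \<open>v\<close>. This links the sizes of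
  planes with the row counts.\<close>

lemma triple_size:
  assumes "(v, u) \<in> set frames"
  shows "(\<Sum>t\<in>UNIV. size3 (plane X v u s t)) = (\<Sum>a\<in>UNIV. rowc X (s \<odot> u + a \<odot> v))"
proof -
  have "(\<Sum>t\<in>UNIV. size3 (plane X v u s t))
    = (\<Sum>a\<in>UNIV. \<Sum>t\<in>UNIV. \<Sum>b\<in>UNIV. of_bool (X (s \<odot> u + a \<odot> v) (t \<odot> u + b \<odot> v)))"
    unfolding size_plane by (rule sum.swap)
  also have "\<dots> = (\<Sum>a\<in>UNIV. rowc X (s \<odot> u + a \<odot> v))"
    unfolding rowc_def using frame_sum[OF assms, of "\<lambda>j. of_bool (X i j) :: int" for i] by simp
  finally show ?thesis .
qed

lemma plane_sizes_sum:
  assumes "(v, u) \<in> set frames"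
  shows "(\<Sum>s\<in>UNIV. \<Sum>t\<in>UNIV. size3 (plane X v u s t)) = cell_count X"
  unfolding triple_size[OF assms] cell_count_def by (rule frame_sum[OF assms])

text \<open>For a fixed direction the planes partition all cells, so their row lines are the lines with
  direction \<open>v\<close> inside the nine rows, and likewise for columns and elements. For elements the index \<open>t\<close>
  of the plane is replaced by \<open>t - s\<close>, since the planes containing a given element are those with
  constant \<open>s + t\<close>.\<close>

lemma direction_energy:
  assumes F: "(v, u) \<in> set frames"
  shows "(\<Sum>s\<in>UNIV. \<Sum>t\<in>UNIV. energy (plane X v u s t))
    = (\<Sum>i\<in>UNIV. \<Sum>t\<in>UNIV. (\<Sum>b\<in>UNIV. of_bool (X i (t \<odot> u + b \<odot> v)))\<^sup>2)
    + (\<Sum>j\<in>UNIV. \<Sum>s\<in>UNIV. (\<Sum>a\<in>UNIV. of_bool (X (s \<odot> u + a \<odot> v) j))\<^sup>2)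
    + (\<Sum>k\<in>UNIV. \<Sum>s\<in>UNIV. (\<Sum>a\<in>UNIV. of_bool (X (s \<odot> u + a \<odot> v) (k - (s \<odot> u + a \<odot> v))))\<^sup>2)"
proof -
  let ?f = "\<lambda>i j. of_bool (X i j) :: int"
  have 1: "(\<Sum>s\<in>UNIV. \<Sum>t\<in>UNIV. \<Sum>a\<in>UNIV. (\<Sum>b\<in>UNIV. ?f (s \<odot> u + a \<odot> v) (t \<odot> u + b \<odot> v))\<^sup>2)
    = (\<Sum>i\<in>UNIV. \<Sum>t\<in>UNIV. (\<Sum>b\<in>UNIV. ?f i (t \<odot> u + b \<odot> v))\<^sup>2)"
    unfolding frame_sum[OF F, symmetric, where f = "\<lambda>i. \<Sum>t\<in>UNIV. (\<Sum>b\<in>UNIV. ?f i (t \<odot> u + b \<odot> v))\<^sup>2"]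
    by (rule sum.cong[OF refl]) (rule sum.swap)
  have 2: "(\<Sum>s\<in>UNIV. \<Sum>t\<in>UNIV. \<Sum>b\<in>UNIV. (\<Sum>a\<in>UNIV. ?f (s \<odot> u + a \<odot> v) (t \<odot> u + b \<odot> v))\<^sup>2)
    = (\<Sum>j\<in>UNIV. \<Sum>s\<in>UNIV. (\<Sum>a\<in>UNIV. ?f (s \<odot> u + a \<odot> v) j)\<^sup>2)"
    unfolding sum.swap[of "\<lambda>j s. (\<Sum>a\<in>UNIV. ?f (s \<odot> u + a \<odot> v) j)\<^sup>2" UNIV UNIV]
    using frame_sum[OF F, of "\<lambda>j. (\<Sum>a\<in>UNIV. ?f (s \<odot> u + a \<odot> v) j)\<^sup>2" for s] by simp
  have 3: "(\<Sum>t\<in>UNIV. \<Sum>k\<in>UNIV. (\<Sum>a\<in>UNIV. ?f (s \<odot> u + a \<odot> v) (t \<odot> u + (k - a) \<odot> v))\<^sup>2)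
    = (\<Sum>k\<in>UNIV. (\<Sum>a\<in>UNIV. ?f (s \<odot> u + a \<odot> v) (k - (s \<odot> u + a \<odot> v)))\<^sup>2)" (is "?L s = ?R s") for s
  proof -
    have "?L s = (\<Sum>t\<in>UNIV. \<Sum>k\<in>UNIV. (\<Sum>a\<in>UNIV. ?f (s \<odot> u + a \<odot> v) ((t - s) \<odot> u + (k - a) \<odot> v))\<^sup>2)"
      by (rule sum_shift[symmetric])
    also have "\<dots> = (\<Sum>t\<in>UNIV. \<Sum>k\<in>UNIV. (\<Sum>a\<in>UNIV. ?f (s \<odot> u + a \<odot> v) ((t \<odot> u + k \<odot> v) - (s \<odot> u + a \<odot> v)))\<^sup>2)"
      by (simp add: smul_diff algebra_simps)
    also have "\<dots> = ?R s"
      by (rule frame_sum[OF F, where f = "\<lambda>k. (\<Sum>a\<in>UNIV. ?f (s \<odot> u + a \<odot> v) (k - (s \<odot> u + a \<odot> v)))\<^sup>2"])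
    finally show ?thesis .
  qed
  have swap3: "(\<Sum>s\<in>UNIV. ?R s) = (\<Sum>k\<in>UNIV. \<Sum>s\<in>UNIV. (\<Sum>a\<in>UNIV. ?f (s \<odot> u + a \<odot> v) (k - (s \<odot> u + a \<odot> v)))\<^sup>2)"
    by (rule sum.swap)
  show ?thesis
    unfolding energy_def plane_def sum.distrib 1 2 3 swap3 ..
qed

lemma of_bool_sq: "(of_bool P :: int)\<^sup>2 = of_bool P" by simp

lemma frames_sum_list: "(\<Sum>(v, u)\<leftarrow>frames. f v u) = (\<Sum>(v, u)\<in>set frames. f v u)"
  for f :: "vec \<Rightarrow> vec \<Rightarrow> int"
  by (rule sum_list_distinct_conv_sum_set) (simp add: frames_def)

text \<open>Summing over the four directions, all lines inside one row (column, element) have been collected, and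
  \<open>line_sum_squares\<close> evaluates the sum to \<open>c\<^sup>2 + 3 c\<close> for \<open>c\<close> cells.\<close>

lemma energy_sum:
  "(\<Sum>(v, u)\<in>set frames. \<Sum>s\<in>UNIV. \<Sum>t\<in>UNIV. energy (plane X v u s t))
    = sqsum (rowc X) + sqsum (colc X) + sqsum (symc X) + 9 * cell_count X"
proof -
  have E: "(\<Sum>x\<in>UNIV. \<Sum>(v, u)\<in>set frames. \<Sum>s\<in>UNIV. (\<Sum>a\<in>UNIV. of_bool (P x (s \<odot> u + a \<odot> v)))\<^sup>2)
     = 3 * (\<Sum>x\<in>UNIV. \<Sum>y\<in>UNIV. of_bool (P x y)) + (\<Sum>x\<in>UNIV. (\<Sum>y\<in>UNIV. of_bool (P x y) :: int)\<^sup>2)"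
    for P :: "vec \<Rightarrow> vec \<Rightarrow> bool"
    unfolding frames_sum_list[symmetric]
      line_sum_squares[of "\<lambda>y. of_bool (P x y)" for x, unfolded of_bool_sq]
    by (simp add: sum.distrib sum_distrib_left del: sum_of_bool_eq)
  have "(\<Sum>(v, u)\<in>set frames. \<Sum>s\<in>UNIV. \<Sum>t\<in>UNIV. energy (plane X v u s t))
    = (\<Sum>(v, u)\<in>set frames. \<Sum>i\<in>UNIV. \<Sum>t\<in>UNIV. (\<Sum>b\<in>UNIV. of_bool (X i (t \<odot> u + b \<odot> v)))\<^sup>2)
    + (\<Sum>(v, u)\<in>set frames. \<Sum>j\<in>UNIV. \<Sum>s\<in>UNIV. (\<Sum>a\<in>UNIV. of_bool (X (s \<odot> u + a \<odot> v) j))\<^sup>2)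
    + (\<Sum>(v, u)\<in>set frames. \<Sum>k\<in>UNIV. \<Sum>s\<in>UNIV. (\<Sum>a\<in>UNIV. of_bool (X (s \<odot> u + a \<odot> v) (k - (s \<odot> u + a \<odot> v))))\<^sup>2)"
    unfolding sum.distrib[symmetric] by (rule sum.cong) (auto simp: direction_energy)
  also have "\<dots> = (\<Sum>i\<in>UNIV. \<Sum>(v, u)\<in>set frames. \<Sum>t\<in>UNIV. (\<Sum>b\<in>UNIV. of_bool (X i (t \<odot> u + b \<odot> v)))\<^sup>2)
    + (\<Sum>j\<in>UNIV. \<Sum>(v, u)\<in>set frames. \<Sum>s\<in>UNIV. (\<Sum>a\<in>UNIV. of_bool (X (s \<odot> u + a \<odot> v) j))\<^sup>2)
    + (\<Sum>k\<in>UNIV. \<Sum>(v, u)\<in>set frames. \<Sum>s\<in>UNIV. (\<Sum>a\<in>UNIV. of_bool (X (s \<odot> u + a \<odot> v) (k - (s \<odot> u + a \<odot> v))))\<^sup>2)"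
    unfolding case_prod_unfold
    by (intro arg_cong2[where f = "(+)"]) (rule sum.swap)+
  also have "\<dots> = sqsum (rowc X) + sqsum (colc X) + sqsum (symc X) + 9 * cell_count X"
    unfolding E[of X] E[of "\<lambda>j i. X i j"] E[of "\<lambda>k i. X i (k - i)"]
    using cell_count_col[of X] cell_count_sym[of X]
    by (simp add: sqsum_def cell_count_def rowc_def[abs_def] colc_def[abs_def] symc_def[abs_def])
  finally show ?thesis .
qed

text \<open>A triple \<open>(f, s, t)\<close> indexes the plane through \<open>(s u, t u)\<close> with direction \<open>v\<close>, where \<open>f = (v, u)\<close>; each of
  the 36 planes has exactly one index.\<close>

definition fat :: "(vec \<Rightarrow> vec \<Rightarrow> bool) \<Rightarrow> ((vec \<times> vec) \<times> trit \<times> trit) set" where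
  "fat X = {(f, s, t). f \<in> set frames \<and> \<not> slim (plane X (fst f) (snd f) s t)}"

definition excess :: "(vec \<Rightarrow> vec \<Rightarrow> bool) \<Rightarrow> int" where
  "excess X = (\<Sum>(v, u)\<in>set frames. \<Sum>s\<in>UNIV. \<Sum>t\<in>UNIV. surplus (size3 (plane X v u s t)))"

lemma finite_fat: "finite (fat X)"
  by (rule finite_subset[of _ "set frames \<times> UNIV \<times> UNIV"]) (auto simp: fat_def)

lemma card_fat:
  "int (card (fat X)) = (\<Sum>(v, u)\<in>set frames. \<Sum>s\<in>UNIV. \<Sum>t\<in>UNIV. of_bool (\<not> slim (plane X v u s t)))"
proof -
  have "fat X = (set frames \<times> UNIV \<times> UNIV) \<inter> {(f, s, t). \<not> slim (plane X (fst f) (snd f) s t)}"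
    by (auto simp: fat_def)
  then have "int (card (fat X)) = (\<Sum>x\<in>set frames \<times> UNIV \<times> UNIV. of_bool (x \<in> {(f, s, t). \<not> slim (plane X (fst f) (snd f) s t)}))"
    by (subst sum_of_bool_eq) auto
  also have "\<dots> = (\<Sum>f\<in>set frames. \<Sum>s\<in>UNIV. \<Sum>t\<in>UNIV. of_bool (\<not> slim (plane X (fst f) (snd f) s t)))"
    by (simp add: sum.cartesian_product case_prod_unfold del: sum_of_bool_eq)
  finally show ?thesis by (simp add: case_prod_unfold del: sum_of_bool_eq)
qed

lemma card_frames: "card (set frames) = 4"
  by (simp add: frames_def)

text \<open>Every plane has at least two cells and the nine planes of one direction share 23 cells, so none
  has more than \<open>23 - 8 * 2\<close>.\<close>

lemma size_bounds:
  assumes H: "hit X" and T: "cell_count X = 23" and F: "(v, u) \<in> set frames"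
  shows "2 \<le> size3 (plane X v u s t)" "size3 (plane X v u s t) \<le> 7"
    "slim (plane X v u s t) \<Longrightarrow> size3 (plane X v u s t) \<le> 3"
    "energy (plane X v u s t) + 2 * of_bool (\<not> slim (plane X v u s t))
      \<le> 9 * size3 (plane X v u s t) - 12 + 2 * surplus (size3 (plane X v u s t))"
proof -
  have lo: "2 \<le> size3 (plane X v u s t)" for s t
    using plane_inequality[OF hits_plane[OF H F]] by blast
  then show "2 \<le> size3 (plane X v u s t)" .
  show le: "size3 (plane X v u s t) \<le> 7"
    using plane_sizes_sum[OF F, of X] lo[of T0 T0] lo[of T0 T1] lo[of T0 T2] lo[of T1 T0] lo[of T1 T1] lo[of T1 T2]
      lo[of T2 T0] lo[of T2 T1] lo[of T2 T2]
    unfolding T sum_trit by (cases s; cases t; simp)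
  show "slim (plane X v u s t) \<Longrightarrow> size3 (plane X v u s t) \<le> 3"
    "energy (plane X v u s t) + 2 * of_bool (\<not> slim (plane X v u s t))
      \<le> 9 * size3 (plane X v u s t) - 12 + 2 * surplus (size3 (plane X v u s t))"
    using plane_inequality[OF hits_plane[OF H F]] le by blast+
qed

text \<open>The plane inequality, summed over all planes: \<open>9 * 4 * 23 - 36 * 12 - 9 * 23 = 189\<close>.\<close>

lemma square_sum_upper:
  assumes H: "hit X" and T: "cell_count X = 23"
  shows "sqsum (rowc X) + sqsum (colc X) + sqsum (symc X) + 2 * int (card (fat X)) \<le> 189 + 2 * excess X"
proof -
  have "(\<Sum>(v, u)\<in>set frames. \<Sum>s\<in>UNIV. \<Sum>t\<in>UNIV. energy (plane X v u s t) + 2 * of_bool (\<not> slim (plane X v u s t)))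
    \<le> (\<Sum>(v, u)\<in>set frames. \<Sum>s\<in>UNIV. \<Sum>t\<in>UNIV. 9 * size3 (plane X v u s t) - 12 + 2 * surplus (size3 (plane X v u s t)))"
    by (intro sum_mono, clarify, intro sum_mono) (rule size_bounds(4)[OF H T])
  also have "(\<Sum>(v, u)\<in>set frames. \<Sum>s\<in>UNIV. \<Sum>t\<in>UNIV. 9 * size3 (plane X v u s t) - 12 + 2 * surplus (size3 (plane X v u s t)))
    = (\<Sum>(v, u)\<in>set frames. 9 * cell_count X - 108 + 2 * (\<Sum>s\<in>UNIV. \<Sum>t\<in>UNIV. surplus (size3 (plane X v u s t))))"
    by (rule sum.cong) (auto simp: plane_sizes_sum[symmetric] sum.distrib sum_subtractf sum_distrib_left UNIV_trit)
  also have "\<dots> = 4 * (9 * 23 - 108) + 2 * excess X"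
    by (simp add: excess_def case_prod_unfold sum.distrib sum_subtractf sum_distrib_left card_frames T)
  also have "(\<Sum>(v, u)\<in>set frames. \<Sum>s\<in>UNIV. \<Sum>t\<in>UNIV. energy (plane X v u s t) + 2 * of_bool (\<not> slim (plane X v u s t)))
    = (sqsum (rowc X) + sqsum (colc X) + sqsum (symc X) + 9 * cell_count X) + 2 * int (card (fat X))"
    unfolding energy_sum[symmetric] card_fat
    by (simp add: case_prod_unfold sum.distrib sum_distrib_left del: sum_of_bool_eq)
  finally show ?thesis by (simp add: T)
qed

text \<open>The parabola lies above its secant through two consecutive integers.\<close>

lemma tangent: "(2 * m + 1) * x - m * (m + 1) \<le> x\<^sup>2" for m x :: int
proof -
  have "0 \<le> (x - m) * (x - (m + 1))" by (cases "x \<le> m") (auto intro: mult_nonpos_nonpos)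
  then show ?thesis by (simp add: algebra_simps power2_eq_square)
qed

text \<open>Here \<open>c s t\<close> are the sizes of the nine planes of a direction and the inner sums are the sizes of the
  three unions of rows. Three integers with sum 23 have square sum at least \<open>8\<^sup>2 + 8\<^sup>2 + 7\<^sup>2 = 177\<close>. A plane with
  six (seven) cells forces a union of size at least ten (eleven), hence a square sum of at
  least \<open>10\<^sup>2 + 7\<^sup>2 + 6\<^sup>2 = 185\<close> (\<open>11\<^sup>2 + 6\<^sup>2 + 6\<^sup>2 = 193\<close>).\<close>

lemma triple_squares:
  fixes c :: "trit \<Rightarrow> trit \<Rightarrow> int"
  assumes tot: "(\<Sum>s\<in>UNIV. \<Sum>t\<in>UNIV. c s t) = 23" and lo: "\<And>s t. 2 \<le> c s t"
  shows "177 + 8 * (\<Sum>s\<in>UNIV. \<Sum>t\<in>UNIV. surplus (c s t)) \<le> (\<Sum>s\<in>UNIV. (\<Sum>t\<in>UNIV. c s t)\<^sup>2)"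
proof (cases "\<exists>s t. 6 \<le> c s t")
  case False
  have "c s t \<le> 5" for s t
  proof -
    have "\<not> 6 \<le> c s t" using False by blast
    then show ?thesis by simp
  qed
  then have "surplus (c s t) = 0" for s t by (simp add: surplus_def)
  moreover have "177 \<le> (\<Sum>s\<in>UNIV. (\<Sum>t\<in>UNIV. c s t)\<^sup>2)"
    using tot tangent[of 7 "\<Sum>t\<in>UNIV. c T0 t"] tangent[of 7 "\<Sum>t\<in>UNIV. c T1 t"] tangent[of 7 "\<Sum>t\<in>UNIV. c T2 t"]
    by (simp add: sum_trit)
  ultimately show ?thesis by simp
next
  case True
  then obtain s t where st: "6 \<le> c s t" by blast
  let ?d = "\<lambda>x. c (fst x) (snd x) - 2"
  have "(\<Sum>x\<in>UNIV \<times> UNIV. ?d x) = (\<Sum>s\<in>UNIV. \<Sum>t\<in>UNIV. c s t - 2)"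
    by (simp add: sum.cartesian_product case_prod_unfold)
  also have "\<dots> = 5" using tot by (simp add: sum_trit)
  finally have d: "(\<Sum>x\<in>A. ?d x) \<le> 5" for A
    using sum_mono2[of "UNIV \<times> UNIV" A ?d] lo by simp
  have le7: "c s t \<le> 7" using d[of "{(s, t)}"] by simp
  have others: "surplus (c s' t') = 0" if "(s', t') \<noteq> (s, t)" for s' t'
    using d[of "{(s, t), (s', t')}"] st that by (auto simp: surplus_def)
  have sur: "(\<Sum>s\<in>UNIV. \<Sum>t\<in>UNIV. surplus (c s t)) = c s t - 5"
  proof -
    have "(\<Sum>s'\<in>UNIV. \<Sum>t'\<in>UNIV. surplus (c s' t')) = (\<Sum>x\<in>UNIV \<times> UNIV. surplus (c (fst x) (snd x)))"
      by (simp add: sum.cartesian_product case_prod_unfold)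
    also have "\<dots> = (\<Sum>x\<in>{(s, t)}. surplus (c (fst x) (snd x)))"
      by (rule sum.mono_neutral_right) (auto simp: others)
    also have "\<dots> = c s t - 5" using st by (simp add: surplus_def)
    finally show ?thesis .
  qed
  define n where "n = (\<lambda>s. \<Sum>t\<in>UNIV. c s t)"
  have n23: "n T0 + n T1 + n T2 = 23" using tot by (simp add: n_def sum_trit)
  have n6: "6 \<le> n s" for s using lo[of s T0] lo[of s T1] lo[of s T2] by (simp add: n_def sum_trit)
  have ns: "c s t + 4 \<le> n s" using lo[of s T0] lo[of s T1] lo[of s T2] by (cases t; simp add: n_def sum_trit)
  have six: "12 * x - 36 \<le> x\<^sup>2" for x :: int
    using zero_le_power2[of "x - 6"] by (simp add: power2_eq_square algebra_simps)
  have "177 + 8 * (c s t - 5) \<le> (n T0)\<^sup>2 + (n T1)\<^sup>2 + (n T2)\<^sup>2"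
  proof (cases "c s t = 6")
    case True
    then show ?thesis
      using tangent[of 10 "n T0"] tangent[of 10 "n T1"] tangent[of 10 "n T2"] tangent[of 6 "n T0"] tangent[of 6 "n T1"] tangent[of 6 "n T2"] n23 ns
      by (cases s) auto
  next
    case False
    then have "c s t = 7" using st le7 by simp
    then show ?thesis
      using tangent[of 11 "n T0"] tangent[of 11 "n T1"] tangent[of 11 "n T2"] six[of "n T0"] six[of "n T1"] six[of "n T2"] n23 ns
      by (cases s) auto
  qed
  then show ?thesis unfolding sur by (simp add: n_def sum_trit)
qed

text \<open>The squares of the sizes of the 12 unions of three rows are summed with \<open>line_sum_squares\<close>, applied to
  the row counts: \<open>4 * 177 - 23\<^sup>2 = 179\<close>.\<close>

lemma square_sum_lower:
  assumes H: "hit X" and T: "cell_count X = 23"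
  shows "179 + 8 * excess X \<le> 3 * sqsum (rowc X)"
proof -
  have "(\<Sum>(v, u)\<in>set frames. 177 + 8 * (\<Sum>s\<in>UNIV. \<Sum>t\<in>UNIV. surplus (size3 (plane X v u s t))))
    \<le> (\<Sum>(v, u)\<in>set frames. \<Sum>s\<in>UNIV. (\<Sum>a\<in>UNIV. rowc X (s \<odot> u + a \<odot> v))\<^sup>2)"
  proof (intro sum_mono, clarify)
    fix v u assume F: "(v, u) \<in> set frames"
    show "177 + 8 * (\<Sum>s\<in>UNIV. \<Sum>t\<in>UNIV. surplus (size3 (plane X v u s t)))
      \<le> (\<Sum>s\<in>UNIV. (\<Sum>a\<in>UNIV. rowc X (s \<odot> u + a \<odot> v))\<^sup>2)"
      unfolding triple_size[OF F, symmetric]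
      by (rule triple_squares) (simp_all add: plane_sizes_sum[OF F] T size_bounds(1)[OF H T F])
  qed
  also have "\<dots> = 3 * sqsum (rowc X) + 23\<^sup>2"
    unfolding frames_sum_list[symmetric] line_sum_squares by (simp add: sqsum_def cell_count_def[symmetric] T)
  finally show ?thesis
    by (simp add: excess_def case_prod_unfold sum.distrib sum_distrib_left card_frames)
qed

section \<open>Symmetries and the distribution of the cells over the rows\<close>

text \<open>This is the least possible distribution of 23 cells, as far as square sums are concerned.\<close>

definition rows23 :: "(vec \<Rightarrow> vec \<Rightarrow> bool) \<Rightarrow> bool" where
  "rows23 X \<longleftrightarrow> (\<forall>i. card {j. X i j} \<in> {2, 3})"

text \<open>The normal form of a row with two cells, its partner row with three cells, and the row in line
  with both, which misses the plane that contains the two cells. The parameter is the position of the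
  third cell of the partner row.\<close>

definition anchored :: "trit \<Rightarrow> (vec \<Rightarrow> vec \<Rightarrow> bool) \<Rightarrow> bool" where
  "anchored \<beta> X \<longleftrightarrow> (\<forall>j. X v00 j \<longleftrightarrow> j = v00 \<or> j = v01) \<and>
     (\<forall>j. X v01 j \<longleftrightarrow> j = v00 \<or> j = v10 \<or> j = (T2, \<beta>)) \<and>
     (\<forall>t. \<not> X v02 (T0, t))"

lemma rowc_card: "rowc X i = int (card {j. X i j})"
  by (simp add: rowc_def)

text \<open>An affine change of coordinates; rows and columns need the same linear part \<open>g\<close>, so that elements are
  mapped to elements.\<close>

definition move :: "vec \<Rightarrow> vec \<Rightarrow> (vec \<Rightarrow> vec) \<Rightarrow> (vec \<Rightarrow> vec \<Rightarrow> bool) \<Rightarrow> vec \<Rightarrow> vec \<Rightarrow> bool" where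
  "move i0 j0 g X i j = X (i0 + g i) (j0 + g j)"

lemma sum_bij: "bij h \<Longrightarrow> (\<Sum>x\<in>UNIV. f (h x)) = (\<Sum>x\<in>UNIV. f x)"
  for f :: "'a \<Rightarrow> 'b :: comm_monoid_add"
  using sum.reindex_bij_betw[of h UNIV UNIV f] by simp

lemma bij_plus: "bij g \<Longrightarrow> bij (\<lambda>x. c + g x)" for g :: "vec \<Rightarrow> vec"
proof -
  assume "bij g"
  have "bij (\<lambda>x::vec. c + x)" by (rule o_bij[of "\<lambda>x. x - c"]) (auto simp: fun_eq_iff)
  then show ?thesis using bij_comp[OF \<open>bij g\<close>, of "\<lambda>x. c + x"] by (simp add: comp_def)
qed

context
  fixes g :: "vec \<Rightarrow> vec"
  assumes add: "\<And>x y. g (x + y) = g x + g y" and bij: "bij g"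
begin

lemma g_zero: "g 0 = 0" using add[of 0 0] by simp
lemma g_minus: "g (- x) = - g x"
  using add[of x "- x"] g_zero by (metis add.right_inverse add_left_imp_eq)
lemma g_diff: "g (x - y) = g x - g y"
  using add[of x "- y"] g_minus by simp

lemma hit_move: assumes H: "hit X" shows "hit (move i0 j0 g X)"
  unfolding hit_def
proof (intro allI impI)
  fix v i j :: vec assume "v \<noteq> 0"
  then have gv: "g v \<noteq> 0" using bij g_zero by (metis bij_pointE)
  have e: "i0 + g (x + y) = i0 + g x + g y" "j0 + g (x + y) = j0 + g x + g y"
    "i0 + g (x - y) = i0 + g x - g y" "j0 + g (x - y) = j0 + g x - g y" for x y
    by (simp_all add: add g_diff algebra_simps)
  show "(move i0 j0 g X i j \<or> move i0 j0 g X i (j+v) \<or> move i0 j0 g X i (j-v) \<or> move i0 j0 g X (i+v) j \<or> move i0 j0 g X (i+v) (j+v) \<or> move i0 j0 g X (i+v) (j-v)) \<and>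
     (move i0 j0 g X i j \<or> move i0 j0 g X (i+v) j \<or> move i0 j0 g X (i-v) j \<or> move i0 j0 g X i (j+v) \<or> move i0 j0 g X (i+v) (j+v) \<or> move i0 j0 g X (i-v) (j+v)) \<and>
     (move i0 j0 g X i j \<or> move i0 j0 g X (i+v) (j-v) \<or> move i0 j0 g X (i-v) (j+v) \<or> move i0 j0 g X i (j+v) \<or> move i0 j0 g X (i+v) j \<or> move i0 j0 g X (i-v) (j-v))"
    unfolding move_def e
    using hit_row[OF H gv, of "i0 + g i" "j0 + g j"] hit_col[OF H gv, of "i0 + g i" "j0 + g j"]
      hit_sym[OF H gv, of "i0 + g i" "j0 + g j"] by blast
qed

lemma rowc_move: "rowc (move i0 j0 g X) i = rowc X (i0 + g i)"
  unfolding rowc_def move_def by (rule sum_bij[OF bij_plus[OF bij]])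

lemma colc_move: "colc (move i0 j0 g X) j = colc X (j0 + g j)"
  unfolding colc_def move_def by (rule sum_bij[OF bij_plus[OF bij], where f = "\<lambda>i. of_bool (X i (j0 + g j))"])

lemma symc_move: "symc (move i0 j0 g X) k = symc X (i0 + j0 + g k)"
proof -
  have "symc (move i0 j0 g X) k = (\<Sum>i\<in>UNIV. of_bool (X (i0 + g i) ((i0 + j0 + g k) - (i0 + g i))))"
    unfolding symc_def move_def by (simp add: g_diff algebra_simps del: sum_of_bool_eq)
  also have "\<dots> = symc X (i0 + j0 + g k)"
    unfolding symc_def by (rule sum_bij[OF bij_plus[OF bij], where f = "\<lambda>i. of_bool (X i ((i0 + j0 + g k) - i))"])
  finally show ?thesis .
qed

lemma cell_count_move: "cell_count (move i0 j0 g X) = cell_count X"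
  unfolding cell_count_def rowc_move by (rule sum_bij[OF bij_plus[OF bij]])

lemma sqsum_move:
  "sqsum (rowc (move i0 j0 g X)) = sqsum (rowc X)"
  "sqsum (colc (move i0 j0 g X)) = sqsum (colc X)"
  "sqsum (symc (move i0 j0 g X)) = sqsum (symc X)"
  unfolding sqsum_def rowc_move colc_move symc_move
  by (rule sum_bij[OF bij_plus[OF bij], where f = "\<lambda>x. (rowc X x)\<^sup>2"]
      sum_bij[OF bij_plus[OF bij], where f = "\<lambda>x. (colc X x)\<^sup>2"]
      sum_bij[OF bij_plus[OF bij], where f = "\<lambda>x. (symc X x)\<^sup>2"])+

end

lemma hit_transpose: "hit X \<Longrightarrow> hit (\<lambda>i j. X j i)"
  unfolding hit_def
proof (intro allI impI)
  fix v i j :: vec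
  assume H: "\<forall>v i j. v \<noteq> 0 \<longrightarrow>
     (X i j \<or> X i (j+v) \<or> X i (j-v) \<or> X (i+v) j \<or> X (i+v) (j+v) \<or> X (i+v) (j-v)) \<and>
     (X i j \<or> X (i+v) j \<or> X (i-v) j \<or> X i (j+v) \<or> X (i+v) (j+v) \<or> X (i-v) (j+v)) \<and>
     (X i j \<or> X (i+v) (j-v) \<or> X (i-v) (j+v) \<or> X i (j+v) \<or> X (i+v) j \<or> X (i-v) (j-v))" and "v \<noteq> 0"
  from H[rule_format, OF \<open>v \<noteq> 0\<close>, of j i] H[rule_format, OF \<open>v \<noteq> 0\<close>, of j i]
  show "(X j i \<or> X (j+v) i \<or> X (j-v) i \<or> X j (i+v) \<or> X (j+v) (i+v) \<or> X (j-v) (i+v)) \<and>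
     (X j i \<or> X j (i+v) \<or> X j (i-v) \<or> X (j+v) i \<or> X (j+v) (i+v) \<or> X (j+v) (i-v)) \<and>
     (X j i \<or> X (j-v) (i+v) \<or> X (j+v) (i-v) \<or> X (j+v) i \<or> X j (i+v) \<or> X (j-v) (i-v))"
    by blast
qed

text \<open>The conjugate that exchanges the roles of rows and elements: the new row of a cell is its old element.
  The sign makes the new element \<open>i + j\<close> correspond to an old row.\<close>

lemma hit_conjugate: "hit X \<Longrightarrow> hit (\<lambda>i j. X (i + j) (- j))"
  unfolding hit_def[of "\<lambda>i j. X (i + j) (- j)"]
proof (intro allI impI)
  fix v i j :: vec
  assume H: "hit X" and v: "v \<noteq> 0"
  have d: "i + v + (j + v) = i + j + v + v" "i - v + (j - v) = i + j - v - v"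
    by (simp_all add: algebra_simps)
  have e: "i + (j + v) = i + j + v" "i + (j - v) = i + j - v" "i + v + j = i + j + v" "i - v + j = i + j - v"
     "i + v + (j - v) = i + j" "i - v + (j + v) = i + j" "- (j + v) = - j - v" "- (j - v) = - j + v"
    by (simp_all add: algebra_simps)
  show "(X (i + j) (- j) \<or> X (i + (j+v)) (- (j+v)) \<or> X (i + (j-v)) (- (j-v)) \<or> X (i+v + j) (- j) \<or> X (i+v + (j+v)) (- (j+v)) \<or> X (i+v + (j-v)) (- (j-v))) \<and>
     (X (i + j) (- j) \<or> X (i+v + j) (- j) \<or> X (i-v + j) (- j) \<or> X (i + (j+v)) (- (j+v)) \<or> X (i+v + (j+v)) (- (j+v)) \<or> X (i-v + (j+v)) (- (j+v))) \<and>
     (X (i + j) (- j) \<or> X (i+v + (j-v)) (- (j-v)) \<or> X (i-v + (j+v)) (- (j+v)) \<or> X (i + (j+v)) (- (j+v)) \<or> X (i+v + j) (- j) \<or> X (i-v + (j-v)) (- (j-v)))"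
    unfolding d e vec_triple(2,3)
    using hit_sym[OF H v, of "i + j + v" "- j - v"] hit_sym[OF H v, of "i + j" "- j"] 
      hit_col[OF H v, of "i + j" "- j - v"] hit_row[OF H v, of "i + j" "- j"] v
    by (simp add: vec_triple; blast)
qed

lemma counts_transpose:
  "rowc (\<lambda>i j. X j i) = colc X" "colc (\<lambda>i j. X j i) = rowc X" "sqsum (symc (\<lambda>i j. X j i)) = sqsum (symc X)"
proof -
  show "rowc (\<lambda>i j. X j i) = colc X" "colc (\<lambda>i j. X j i) = rowc X"
    by (simp_all add: rowc_def[abs_def] colc_def[abs_def])
  have "symc (\<lambda>i j. X j i) k = symc X k" for k
    unfolding symc_def by (rule sum.reindex_bij_witness[of _ "\<lambda>i. k - i" "\<lambda>i. k - i"]) auto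
  then show "sqsum (symc (\<lambda>i j. X j i)) = sqsum (symc X)" by (simp add: sqsum_def)
qed

lemma counts_conjugate:
  "rowc (\<lambda>i j. X (i + j) (- j)) = symc X" 
  "sqsum (colc (\<lambda>i j. X (i + j) (- j))) = sqsum (colc X)"
  "sqsum (symc (\<lambda>i j. X (i + j) (- j))) = sqsum (rowc X)"
proof -
  have "rowc (\<lambda>i j. X (i + j) (- j)) i = symc X i" for i
    unfolding rowc_def symc_def by (rule sum.reindex_bij_witness[of _ "\<lambda>x. x - i" "\<lambda>j. i + j"]) auto
  then show "rowc (\<lambda>i j. X (i + j) (- j)) = symc X" by blast
  have "colc (\<lambda>i j. X (i + j) (- j)) j = colc X (- j)" for j
    unfolding colc_def by (rule sum.reindex_bij_witness[of _ "\<lambda>x. x - j" "\<lambda>i. i + j"]) auto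
  moreover have "(\<Sum>j\<in>UNIV. (colc X (- j))\<^sup>2) = (\<Sum>j\<in>UNIV. (colc X j)\<^sup>2)"
    by (rule sum.reindex_bij_witness[of _ uminus uminus]) auto
  ultimately show "sqsum (colc (\<lambda>i j. X (i + j) (- j))) = sqsum (colc X)"
    by (simp add: sqsum_def)
  have "symc (\<lambda>i j. X (i + j) (- j)) k = rowc X k" for k
    unfolding symc_def rowc_def by (rule sum.reindex_bij_witness[of _ "\<lambda>x. x + k" "\<lambda>i. i - k"]) (auto simp: algebra_simps)
  then show "sqsum (symc (\<lambda>i j. X (i + j) (- j))) = sqsum (rowc X)" by (simp add: sqsum_def)
qed

text \<open>The three classes are interchangeable, so rows may be taken to have the least square sum.\<close>

lemma least_class:
  assumes H: "hit X" and T: "cell_count X = 23"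
  obtains Y where "hit Y" "cell_count Y = 23" "sqsum (rowc Y) \<le> sqsum (colc Y)" "sqsum (rowc Y) \<le> sqsum (symc Y)"
proof -
  let ?R = "sqsum (rowc X)" and ?C = "sqsum (colc X)" and ?S = "sqsum (symc X)"
  consider "?R \<le> ?C \<and> ?R \<le> ?S" | "?C \<le> ?R \<and> ?C \<le> ?S" | "?S \<le> ?R \<and> ?S \<le> ?C" by linarith
  then show ?thesis
  proof cases
    case 1
    then show ?thesis using that[OF H T] by blast
  next
    case 2
    have "cell_count (\<lambda>i j. X j i) = 23"
      unfolding cell_count_def[of "\<lambda>i j. X j i"] counts_transpose(1)[of X] using cell_count_col[of X] T by simp
    then show ?thesis
      by (rule that[OF hit_transpose[OF H]]) (use 2 in \<open>simp_all only: counts_transpose[of X]\<close>)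
  next
    case 3
    have "cell_count (\<lambda>i j. X (i + j) (- j)) = 23"
      unfolding cell_count_def[of "\<lambda>i j. X (i + j) (- j)"] counts_conjugate(1)[of X] using cell_count_sym[of X] T by simp
    then show ?thesis
      by (rule that[OF hit_conjugate[OF H]]) (use 3 in \<open>simp_all only: counts_conjugate[of X]\<close>)
  qed
qed

text \<open>The product \<open>(n - 2) * (n - 3)\<close> measures how far a row count is from the ideal values two and three; it is
  an even number.\<close>

lemma gap_nonneg: "0 \<le> (n - 2) * (n - 3)" for n :: int
  by (cases "n \<le> 2") (auto intro: mult_nonpos_nonpos)

lemma card_vec: "card (UNIV :: vec set) = 9"
  by (simp add: UNIV_Times_UNIV[symmetric] card_cartesian_product UNIV_trit del: UNIV_Times_UNIV)

lemma sum_gap: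
  assumes "(\<Sum>i\<in>UNIV. f i) = 23"
  shows "(\<Sum>i\<in>UNIV. (f i - 2) * (f i - 3)) = sqsum f - 61"
proof -
  have "(\<Sum>i\<in>UNIV. (f i - 2) * (f i - 3)) = (\<Sum>i\<in>UNIV. (f i)\<^sup>2 - 5 * f i + 6)"
    by (simp add: algebra_simps power2_eq_square)
  also have "\<dots> = sqsum f - 5 * 23 + 54"
    unfolding sum.distrib sum_subtractf sum_distrib_left[symmetric] assms sqsum_def by (simp add: card_vec)
  finally show ?thesis by simp
qed

text \<open>With \<open>R\<close> the least of the three square sums, the two bounds read
  \<open>179 + 8 * excess X \<le> 3 * R \<le> 189 + 2 * excess X - 2 * card (fat X)\<close>. Hence \<open>excess X \<le> 1\<close>, and the odd number
  \<open>R \<ge> 61\<close> is 61 or 63.\<close>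

lemma profile:
  assumes H: "hit X" and T: "cell_count X = 23"
    and le: "sqsum (rowc X) \<le> sqsum (colc X)" "sqsum (rowc X) \<le> sqsum (symc X)"
  shows "(sqsum (rowc X) = 61 \<and> card (fat X) \<le> 3) \<or>
     (sqsum (rowc X) = 63 \<and> int (card (fat X)) \<le> excess X \<and> excess X \<le> 1)"
proof -
  have up: "3 * sqsum (rowc X) + 2 * int (card (fat X)) \<le> 189 + 2 * excess X"
    using square_sum_upper[OF H T] le by simp
  have lo: "179 + 8 * excess X \<le> 3 * sqsum (rowc X)" by (rule square_sum_lower[OF H T])
  have ex0: "0 \<le> excess X"
    unfolding excess_def by (intro sum_nonneg) (auto intro!: sum_nonneg simp: surplus_def)
  have "even (\<Sum>i\<in>UNIV. (rowc X i - 2) * (rowc X i - 3))"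
    by (intro dvd_sum) auto
  moreover have "0 \<le> (\<Sum>i\<in>UNIV. (rowc X i - 2) * (rowc X i - 3))" by (intro sum_nonneg gap_nonneg)
  ultimately have "even (sqsum (rowc X) - 61)" "61 \<le> sqsum (rowc X)"
    using sum_gap[of "rowc X"] T by (simp_all add: cell_count_def)
  then obtain m where m: "sqsum (rowc X) - 61 = 2 * m" by (meson evenE)
  with \<open>61 \<le> sqsum (rowc X)\<close> have m0: "0 \<le> m" by simp
  have v10: "0 \<le> int (card (fat X))" by simp
  from up lo ex0 m m0 v10 have "m \<le> 1" by linarith
  then consider "m = 0" | "m = 1" using m0 by linarith
  then show ?thesis
  proof cases
    case 1 then show ?thesis using up lo ex0 m by linarith
  next
    case 2 then show ?thesis using up lo ex0 m v10 by linarith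
  qed
qed

section \<open>Rows with two cells and their normal form\<close>

lemma frame_inj:
  assumes "(v, u) \<in> set frames"
  shows "s \<odot> u + a \<odot> v = s' \<odot> u + a' \<odot> v \<longleftrightarrow> s = s' \<and> a = a'"
proof -
  from assms have "(v, u) = (v01, v10) \<or> (v, u) = (v10, v01) \<or> (v, u) = (v11, v01) \<or> (v, u) = (v12, v01)"
    by (auto simp: frames_def)
  then show ?thesis
    by (elim disjE; cases s; cases a; cases s'; cases a') (simp_all add: smul_def trit_simps del: smul_simps)
qed

lemma frame_surj:
  assumes "(v, u) \<in> set frames"
  obtains s a where "x = s \<odot> u + a \<odot> v"
proof -
  from assms have "(v, u) = (v01, v10) \<or> (v, u) = (v10, v01) \<or> (v, u) = (v11, v01) \<or> (v, u) = (v12, v01)"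
    by (auto simp: frames_def)
  then have "\<exists>s a. x = s \<odot> u + a \<odot> v"
    by (elim disjE; cases x; cases "fst x"; cases "snd x") (simp_all add: ex_trit smul_def trit_simps del: smul_simps)
  then show ?thesis using that by blast
qed

lemma frame_joining:
  assumes "x \<noteq> y"
  obtains v u t b c where "(v, u) \<in> set frames" "x = t \<odot> u + b \<odot> v" "y = t \<odot> u + c \<odot> v"
proof -
  have "\<exists>(v, u)\<in>set frames. \<exists>e. d = e \<odot> v" if "d \<noteq> 0" for d
    using that unfolding frames_def
    by (cases d; cases "fst d"; cases "snd d") (auto simp: smul_def trit_simps ex_trit)
  from this[of "y - x"] assms obtain v u e where F: "(v, u) \<in> set frames" and e: "y - x = e \<odot> v"
    by auto
  obtain t b where "x = t \<odot> u + b \<odot> v" using frame_surj[OF F] by blast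
  moreover from this e have "y = t \<odot> u + (b + e) \<odot> v" by (simp add: smul_add algebra_simps)
  ultimately show ?thesis using that[OF F] by blast
qed

text \<open>The row \<open>i\<close> has two cells, and they lie in the plane with index \<open>(f, s, t)\<close>, where \<open>i\<close> is the row with
  index \<open>a\<close>.\<close>

definition pair_row :: "(vec \<Rightarrow> vec \<Rightarrow> bool) \<Rightarrow> vec \<Rightarrow> vec \<times> vec \<Rightarrow> trit \<Rightarrow> trit \<Rightarrow> trit \<Rightarrow> bool" where
  "pair_row X i f s a t \<longleftrightarrow> f \<in> set frames \<and> i = s \<odot> snd f + a \<odot> fst f \<and> card {j. X i j} = 2 \<and>
     (\<forall>j. X i j \<longrightarrow> (\<exists>b. j = t \<odot> snd f + b \<odot> fst f))"

lemma pair_rowE: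
  assumes "card {j. X i j} = 2"
  obtains f s a t where "pair_row X i f s a t"
proof -
  from assms obtain x y where xy: "{j. X i j} = {x, y}" "x \<noteq> y" by (auto simp: card_2_iff)
  from \<open>x \<noteq> y\<close> obtain v u t b c where F: "(v, u) \<in> set frames" "x = t \<odot> u + b \<odot> v" "y = t \<odot> u + c \<odot> v"
    by (rule frame_joining)
  obtain s a where "i = s \<odot> u + a \<odot> v" using frame_surj[OF F(1)] by blast
  moreover have "X i j \<longleftrightarrow> j = x \<or> j = y" for j using xy by blast
  ultimately have "pair_row X i (v, u) s a t"
    unfolding pair_row_def fst_conv snd_conv using F assms by blast
  then show ?thesis by (rule that)
qed

lemma pair_row_empty:
  assumes "pair_row X i f s a t" "t' \<noteq> t"
  shows "\<not> plane X (fst f) (snd f) s t' a b"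
  using assms frame_inj[of "fst f" "snd f"] unfolding pair_row_def plane_def by (metis prod.collapse)

lemma third_trit:
  fixes t t' :: trit
  obtains t'' where "t'' \<noteq> t" "t'' \<noteq> t'"
  by (cases t; cases t'; auto)

text \<open>Two such rows with the same direction cannot be parallel along it: among the three planes in
  which both rows lie there is one that contains cells of neither row, and that plane would miss two
  rows.\<close>

lemma pair_row_unique:
  assumes H: "hit X" and "pair_row X i f s a t" "pair_row X i' f s a' t'"
  shows "i = i'"
proof (rule ccontr)
  assume "i \<noteq> i'"
  with assms have "a \<noteq> a'" by (auto simp: pair_row_def)
  obtain t'' where "t'' \<noteq> t" "t'' \<noteq> t'" by (rule third_trit)
  then have "\<not> plane X (fst f) (snd f) s t'' a b" "\<not> plane X (fst f) (snd f) s t'' a' b" for b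
    using pair_row_empty assms by blast+
  moreover have "hits (plane X (fst f) (snd f) s t'')"
    using assms by (intro hits_plane) (auto simp: pair_row_def)
  ultimately show False using \<open>a \<noteq> a'\<close> unfolding hits_def by blast
qed

text \<open>A slim pattern with two cells in a row is a triangle: the third cell shares the column of one of the
  two cells and the element of the other.\<close>

lemma slim_pair:
  assumes "hits p" "slim p" "p a bx" "p a bz" "bx \<noteq> bz"
  shows "\<exists>b e. e \<noteq> T0 \<and> p a b \<and> p a (b + e) \<and> p (a + e) b \<and> (\<forall>c. \<not> p (a - e) c)"
  using assms unfolding hits_def slim_def
  by (cases a; cases bx; cases bz; simp add: all_trit ex_trit trit_simps; argo)

lemma card_inj_image_le:
  assumes "\<And>x. x \<in> A \<Longrightarrow> \<exists>y \<in> B. R x y" and "\<And>x x' y. x \<in> A \<Longrightarrow> x' \<in> A \<Longrightarrow> R x y \<Longrightarrow> R x' y \<Longrightarrow> x = x'" and "finite B"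
  shows "card A \<le> card B"
proof -
  from assms(1) obtain h where h: "\<And>x. x \<in> A \<Longrightarrow> h x \<in> B \<and> R x (h x)" by metis
  show ?thesis
    by (rule card_inj_on_le[of h]) (use h assms in \<open>auto intro!: inj_onI, metis\<close>)
qed

definition good_row :: "(vec \<Rightarrow> vec \<Rightarrow> bool) \<Rightarrow> vec \<Rightarrow> vec \<times> vec \<Rightarrow> trit \<Rightarrow> trit \<Rightarrow> trit \<Rightarrow> bool" where
  "good_row X i f s a t \<longleftrightarrow> pair_row X i f s a t \<and> slim (plane X (fst f) (snd f) s t)"

text \<open>By \<open>pair_row_unique\<close>, distinct rows with two cells have distinct planes, so at most \<open>card (fat X)\<close> of them
  have a plane that is not slim.\<close>

lemma many_good:
  assumes H: "hit X"
  shows "card {i. card {j. X i j} = 2} \<le> card (fat X) + card {i. \<exists>f s a t. good_row X i f s a t}"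
proof -
  let ?A = "{i. card {j. X i j} = 2}" and ?G = "{i. \<exists>f s a t. good_row X i f s a t}"
  have "card (?A - ?G) \<le> card (fat X)"
  proof (rule card_inj_image_le[where R = "\<lambda>i (f, s, t). \<exists>a. pair_row X i f s a t"])
    fix i assume "i \<in> ?A - ?G"
    then obtain f s a t where P: "pair_row X i f s a t" "\<not> good_row X i f s a t"
      by (auto elim: pair_rowE)
    then have "(f, s, t) \<in> fat X" by (auto simp: fat_def good_row_def pair_row_def)
    then show "\<exists>y\<in>fat X. (case y of (f, s, t) \<Rightarrow> \<exists>a. pair_row X i f s a t)" using P by blast
  next
    fix x x' y
    assume "case y of (f, s, t) \<Rightarrow> \<exists>a. pair_row X x f s a t" "case y of (f, s, t) \<Rightarrow> \<exists>a. pair_row X x' f s a t"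
    moreover obtain f s t where "y = (f, s, t)" by (cases y)
    ultimately show "x = x'" using pair_row_unique[OF H, of x f s _ t x' _ t] by auto
  qed (rule finite_fat)
  moreover have "card ?A \<le> card (?A - ?G) + card ?G"
    using card_Un_le[of "?A - ?G" ?G] card_mono[of "?A - ?G \<union> ?G" ?A] by (simp add: Un_Diff_cancel2)
  ultimately show ?thesis by simp
qed

text \<open>The row \<open>k\<close> of the third cell of the triangle is the partner of the row \<open>i\<close>; the third row of the plane is
  empty there.\<close>

lemma slim_partner:
  assumes H: "hit X" and G: "good_row X i f s a t"
  obtains j0 v k where "v \<noteq> 0" "k = i + v" "\<exists>e. k = s \<odot> snd f + e \<odot> fst f" 
    "\<And>j. X i j \<longleftrightarrow> j = j0 \<or> j = j0 + v"
    "X k j0" "\<not> X (i - v) j0" "\<not> X (i - v) (j0 + v)" "\<not> X (i - v) (j0 - v)"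
proof -
  obtain v0 u where f: "f = (v0, u)" by (cases f)
  from G have P: "pair_row X i (v0, u) s a t" and S: "slim (plane X v0 u s t)" by (simp_all add: good_row_def f)
  then have F: "(v0, u) \<in> set frames" and i: "i = s \<odot> u + a \<odot> v0" and v22: "card {j. X i j} = 2"
    and con: "\<And>j. X i j \<Longrightarrow> \<exists>b. j = t \<odot> u + b \<odot> v0" by (auto simp: pair_row_def)
  from v22 obtain x y where xy: "{j. X i j} = {x, y}" "x \<noteq> y" by (auto simp: card_2_iff)
  then have X: "X i j \<longleftrightarrow> j = x \<or> j = y" for j by blast
  obtain bx bz where b: "x = t \<odot> u + bx \<odot> v0" "y = t \<odot> u + bz \<odot> v0" using con[of x] con[of y] X by blast
  let ?p = "plane X v0 u s t"
  have "?p a bx" "?p a bz" "bx \<noteq> bz" using X b xy(2) by (auto simp: plane_def i[symmetric])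
  from slim_pair[OF hits_plane[OF H F] S this] obtain c e where e: "e \<noteq> T0" "?p a c" "?p a (c + e)"
    "?p (a + e) c" "\<And>c. \<not> ?p (a - e) c" by blast
  define j0 v where "j0 = t \<odot> u + c \<odot> v0" and "v = e \<odot> v0"
  have cell: "?p (a + x) (c + y) = X (i + x \<odot> v0) (j0 + y \<odot> v0)" "?p (a + x) c = X (i + x \<odot> v0) j0"
    "?p (a + x) (c - y) = X (i + x \<odot> v0) (j0 - y \<odot> v0)"  "?p a (c + y) = X i (j0 + y \<odot> v0)" "?p a c = X i j0"
    "?p (a - x) (c + y) = X (i - x \<odot> v0) (j0 + y \<odot> v0)" "?p (a - x) (c - y) = X (i - x \<odot> v0) (j0 - y \<odot> v0)"
    "?p (a - x) c = X (i - x \<odot> v0) j0" for x y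
    by (simp_all add: plane_def i j0_def smul_add smul_diff add.assoc add_diff_eq)
  have v: "v \<noteq> 0"
    using e(1) frame_inj[OF F, of T0 e T0 T0] by (auto simp: v_def)
  have "X i j0" "X i (j0 + v)" using e(2,3) by (simp_all add: cell v_def)
  moreover have "j0 \<noteq> j0 + v" using v by simp
  ultimately have "X i j \<longleftrightarrow> j = j0 \<or> j = j0 + v" for j unfolding X by metis
  moreover have "\<exists>e'. i + v = s \<odot> snd f + e' \<odot> fst f"
    by (rule exI[of _ "a + e"]) (simp add: i v_def f smul_add add.assoc)
  moreover have "X (i + v) j0"
    using e(4) by (simp add: cell v_def)
  moreover have "\<not> X (i - v) j0" "\<not> X (i - v) (j0 + v)" "\<not> X (i - v) (j0 - v)"
    using e(5)[of c] e(5)[of "c + e"] e(5)[of "c - e"] by (simp_all add: cell v_def)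
  ultimately show ?thesis using that[OF v refl] by blast
qed

lemma linear_bij:
  assumes v: "v \<noteq> 0" and w: "w \<noteq> 0" "w \<noteq> v" "w \<noteq> - v"
  defines "g \<equiv> \<lambda>x. snd x \<odot> v + fst x \<odot> w"
  shows "bij g" "g (x + y) = g x + g y"
proof -
  show add: "g (x + y) = g x + g y" for x y
    by (simp add: g_def smul_add algebra_simps)
  have ker: "x = 0" if "g x = 0" for x
  proof (cases "fst x")
    case T0
    then have "snd x \<odot> v = 0" using that by (simp add: g_def)
    then have "snd x = T0" using v by (cases "snd x") auto
    then show ?thesis using T0 by (cases x) (simp add: zero_prod_def zero_trit_def)
  next
    case T1
    then show ?thesis using that w by (cases "snd x") (auto simp: g_def add_eq_0_iff)
  next
    case T2
    then show ?thesis using that w by (cases "snd x") (auto simp: g_def add_eq_0_iff)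
  qed
  have "inj g"
  proof (rule injI)
    fix x y assume "g x = g y"
    moreover have "g ((x - y) + y) = g (x - y) + g y" by (rule add)
    ultimately show "x = y" using ker[of "x - y"] by simp
  qed
  then show "bij g" by (simp add: bij_def finite_UNIV_inj_surj)
qed

text \<open>Adding a multiple of \<open>v\<close> does not move a vector onto the line spanned by \<open>v\<close>.\<close>

lemma off_line_shift:
  fixes v w :: vec
  assumes "w \<noteq> 0" "w \<noteq> v" "w \<noteq> - v"
  shows "w + c \<odot> v \<noteq> 0" "w + c \<odot> v \<noteq> v" "w + c \<odot> v \<noteq> - v"
proof -
  have "w + v \<noteq> 0" using assms(3) by (simp add: eq_neg_iff_add_eq_0)
  moreover have "w + v \<noteq> v" using assms(1) by simp
  moreover have "w + v \<noteq> - v"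
    using assms(2) vec_triple(3)[of 0 v] by (metis add_diff_cancel diff_0 add_0)
  moreover have "w - v \<noteq> 0" using assms(2) by simp
  moreover have "w - v \<noteq> v" using assms(3) vec_triple(1)[of v] by (metis diff_add_cancel)
  moreover have "w - v \<noteq> - v" using assms(1) by (metis diff_add_cancel add.left_inverse)
  ultimately show "w + c \<odot> v \<noteq> 0" "w + c \<odot> v \<noteq> v" "w + c \<odot> v \<noteq> - v"
    using assms by (cases c; simp)+
qed

text \<open>In the two planes parallel to that of the two cells, row \<open>i\<close> is empty and the other two rows must be
  hit. So the partner row has cells on both other lines with direction \<open>v\<close>.\<close>

lemma partner_cells:
  assumes H: "hit X" and v: "v \<noteq> 0" and row: "\<And>j. X i j \<longleftrightarrow> j = j0 \<or> j = j0 + v"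
  obtains w \<beta> where "w \<noteq> 0" "w \<noteq> v" "w \<noteq> - v" "X (i + v) (j0 + w)" "X (i + v) (j0 + (- w + \<beta> \<odot> v))"
proof -
  have "{0, v, - v} \<noteq> UNIV"
    using card_length[of "[0, v, - v]"] card_vec by auto
  then obtain w0 where w0: "w0 \<noteq> 0" "w0 \<noteq> v" "w0 \<noteq> - v" by blast
  have off: "\<not> X i (j0 + w)" "\<not> X i (j0 + w + v)" "\<not> X i (j0 + w - v)" if "w \<noteq> 0" "w \<noteq> v" "w \<noteq> - v" for w
    using that vec_triple[of v] by (auto simp: row add_eq_0_iff2 algebra_simps)
  have hitk: "\<exists>c. X (i + v) (j0 + (w + c \<odot> v))" if "w \<noteq> 0" "w \<noteq> v" "w \<noteq> - v" for w
  proof -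
    have "X (i + v) (j0 + w) \<or> X (i + v) (j0 + w + v) \<or> X (i + v) (j0 + w - v)"
      using hit_row[OF H v, of i "j0 + w"] off[OF that] by simp
    then show ?thesis by (simp add: ex_trit add.assoc add_diff_eq)
  qed
  from hitk[OF w0] obtain c where c: "X (i + v) (j0 + (w0 + c \<odot> v))" by blast
  define w where "w = w0 + c \<odot> v"
  have w: "w \<noteq> 0" "w \<noteq> v" "w \<noteq> - v"
    unfolding w_def by (rule off_line_shift[OF w0])+
  then have "- w \<noteq> 0" "- w \<noteq> v" "- w \<noteq> - v" by auto
  from hitk[OF this] obtain \<beta> where "X (i + v) (j0 + (- w + \<beta> \<odot> v))" by blast
  with w c show ?thesis by (intro that[of w \<beta>]) (simp_all add: w_def)
qed

lemma partner_distinct: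
  assumes "v \<noteq> 0" "w \<noteq> 0" "w \<noteq> v" "w \<noteq> - v"
  shows "card {j0, j0 + w, j0 + (- w + \<beta> \<odot> v)} = 3"
proof -
  let ?g = "\<lambda>x. snd x \<odot> v + fst x \<odot> w"
  have "bij ?g" using linear_bij[OF assms] by blast
  then have "inj (\<lambda>x. j0 + ?g x)" by (simp add: inj_def bij_def)
  from card_image[OF inj_on_subset[OF this subset_UNIV]]
  have "card ((\<lambda>x. j0 + ?g x) ` {v00, v10, (T2, \<beta>)}) = card {v00, v10, (T2, \<beta>)}" .
  then show ?thesis by (simp add: add.commute)
qed

text \<open>The origin is the column \<open>j0\<close> of row \<open>i\<close>; the basis consists of \<open>v\<close> and of the vector \<open>w\<close> that leads
  from \<open>j0\<close> to the second cell of the partner row. The third cell of that row lies on the remaining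
  line with direction \<open>v\<close>, so only its offset \<open>\<beta>\<close> is left open.\<close>

lemma anchored_move:
  assumes H: "hit X" and v: "v \<noteq> 0" and k: "k = i + v"
    and row: "\<And>j. X i j \<longleftrightarrow> j = j0 \<or> j = j0 + v"
    and kk: "X k j0"
    and l: "\<not> X (i - v) j0" "\<not> X (i - v) (j0 + v)" "\<not> X (i - v) (j0 - v)"
    and three: "card {j. X k j} = 3"
  obtains g \<beta> where "bij g" "\<And>x y. g (x + y) = g x + g y" "anchored \<beta> (move i j0 g X)"
proof -
  obtain w \<beta> where w: "w \<noteq> 0" "w \<noteq> v" "w \<noteq> - v" and Xw: "X k (j0 + w)" and Xb: "X k (j0 + (- w + \<beta> \<odot> v))"
    using partner_cells[OF H v row] unfolding k by blast
  define g where "g = (\<lambda>x. snd x \<odot> v + fst x \<odot> w)"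
  have bij: "bij g" and add: "\<And>x y. g (x + y) = g x + g y"
    unfolding g_def using linear_bij[OF v w] by blast+
  then have inj: "g x = g y \<longleftrightarrow> x = y" for x y by (metis bij_pointE)
  have vals: "g v00 = 0" "g v01 = v" "g v02 = - v" "g v10 = w" "g (T2, \<beta>) = - w + \<beta> \<odot> v"
    by (simp_all add: g_def)
  have X3: "X k j \<longleftrightarrow> j = j0 \<or> j = j0 + g v10 \<or> j = j0 + g (T2, \<beta>)" for j
  proof -
    have "card {j0, j0 + g v10, j0 + g (T2, \<beta>)} = 3"
      unfolding vals by (rule partner_distinct[OF v w])
    moreover have "{j0, j0 + g v10, j0 + g (T2, \<beta>)} \<subseteq> {j. X k j}" using kk Xw Xb by (simp add: vals)
    ultimately have "{j0, j0 + g v10, j0 + g (T2, \<beta>)} = {j. X k j}" using three by (intro card_subset_eq) auto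
    then show ?thesis by blast
  qed
  have eq: "j0 + g x = j0 + g y \<longleftrightarrow> x = y" for x y by (simp add: inj)
  have "anchored \<beta> (move i j0 g X)"
    unfolding anchored_def move_def
  proof (intro conjI allI)
    fix j
    have "X (i + g v00) (j0 + g j) \<longleftrightarrow> j0 + g j = j0 + g v00 \<or> j0 + g j = j0 + g v01"
      by (simp only: row vals add_0_right)
    then show "X (i + g v00) (j0 + g j) \<longleftrightarrow> j = v00 \<or> j = v01" by (simp only: eq)
    have "X (i + g v01) (j0 + g j) \<longleftrightarrow> j0 + g j = j0 + g v00 \<or> j0 + g j = j0 + g v10 \<or> j0 + g j = j0 + g (T2, \<beta>)"
      by (simp only: X3 vals(1,2) k[symmetric] add_0_right)
    then show "X (i + g v01) (j0 + g j) \<longleftrightarrow> j = v00 \<or> j = v10 \<or> j = (T2, \<beta>)" by (simp only: eq)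
    fix t show "\<not> X (i + g v02) (j0 + g (T0, t))"
      using l by (cases t) (simp_all add: vals)
  qed
  then show ?thesis using that bij add by blast
qed

section \<open>Planes that cannot all be slim\<close>

text \<open>Each lemma of the form \<open>region\<close> below has the same proof. The assumption that a plane is slim is a choice
  among the three lines of a class that it may miss; an empty line makes further cells necessary because of
  \<open>hit\<close>, and cells exclude other cells because rows have at most three of them. The listed instances are the
  propositional clauses of one finite case analysis that refutes all choices: \<open>hr\<close>, \<open>hc\<close> and \<open>hs\<close> take a
  direction and a cell, \<open>nr\<close>, \<open>nc\<close> and \<open>ns\<close> the index of a plane, \<open>m4\<close> four columns and a row,
  and \<open>m2\<close> a column and a row.

  The digit in the name of a part is the value of \<open>\<beta>\<close>. The parts with \<open>rows\<close> in their name depend on the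
  row counts, those with \<open>free\<close> do not. For each \<open>\<beta>\<close>, the four parts of the first kind are disjoint, and so are the
  two parts of the second kind; this turns them into four and two distinct planes that are not slim.\<close>

lemma slim_row: "slim p \<Longrightarrow> (\<not> p T0 T0 \<and> \<not> p T0 T1 \<and> \<not> p T0 T2) \<or> (\<not> p T1 T0 \<and> \<not> p T1 T1 \<and> \<not> p T1 T2) \<or> (\<not> p T2 T0 \<and> \<not> p T2 T1 \<and> \<not> p T2 T2)"
  and slim_col: "slim p \<Longrightarrow> (\<not> p T0 T0 \<and> \<not> p T1 T0 \<and> \<not> p T2 T0) \<or> (\<not> p T0 T1 \<and> \<not> p T1 T1 \<and> \<not> p T2 T1) \<or> (\<not> p T0 T2 \<and> \<not> p T1 T2 \<and> \<not> p T2 T2)"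
  and slim_sym: "slim p \<Longrightarrow> (\<not> p T0 T0 \<and> \<not> p T1 T2 \<and> \<not> p T2 T1) \<or> (\<not> p T0 T1 \<and> \<not> p T1 T0 \<and> \<not> p T2 T2) \<or> (\<not> p T0 T2 \<and> \<not> p T1 T1 \<and> \<not> p T2 T0)"
  by (simp_all add: slim_def all_trit ex_trit minus_trit_simps zero_trit_def)

lemma rows23_le:
  assumes "rows23 X" "distinct [j1, j2, j3, j4]"
  shows "\<not> (X i j1 \<and> X i j2 \<and> X i j3 \<and> X i j4)"
proof
  assume *: "X i j1 \<and> X i j2 \<and> X i j3 \<and> X i j4"
  have "card {j1, j2, j3, j4} \<le> card {j. X i j}" using * by (intro card_mono) auto
  moreover have "card {j1, j2, j3, j4} = 4" using assms(2) by simp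
  moreover have "card {j. X i j} \<in> {2, 3}" using assms(1) unfolding rows23_def by blast
  ultimately show False by auto
qed

lemma rows23_ge:
  assumes "rows23 X"
  shows "\<exists>j. j \<noteq> j0 \<and> X i j"
proof (rule ccontr)
  assume "\<not> ?thesis"
  then have "{j. X i j} \<subseteq> {j0}" by auto
  then have "card {j. X i j} \<le> 1" using card_mono[of "{j0}" "{j. X i j}"] by simp
  moreover have "card {j. X i j} \<in> {2, 3}" using assms unfolding rows23_def by blast
  ultimately show False by auto
qed

lemma anchoredD:
  assumes "anchored \<beta> X"
  shows "X v00 j \<longleftrightarrow> j = v00 \<or> j = v01" "X v01 j \<longleftrightarrow> j = v00 \<or> j = v10 \<or> j = (T2, \<beta>)"
    "X v02 (T0, t) \<longleftrightarrow> False"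
  using assms unfolding anchored_def by blast+

lemma ex_vec: "(\<exists>x. P x) \<longleftrightarrow> (\<exists>s t. P (s, t))" for P :: "vec \<Rightarrow> bool"
  by simp

lemmas cell_simps = trit_simps prod.case fst_conv snd_conv plane_def smul_def ex_vec ex_trit

definition "part_rows0a =
  [((v01,v10),T0,T1), ((v01,v10),T0,T2), ((v01,v10),T1,T1), ((v10,v01),T2,T0), ((v10,v01),T2,T2),
  ((v11,v01),T0,T0), ((v11,v01),T0,T1), ((v11,v01),T0,T2), ((v11,v01),T1,T1), ((v12,v01),T2,T0),
  ((v12,v01),T2,T1), ((v12,v01),T2,T2)]"

lemma region_rows0a:
  assumes H: "hit X" and A: "anchored T0 X" and R: "rows23 X"
    and S: "\<And>v u s t. ((v,u),s,t) \<in> set part_rows0a \<Longrightarrow> slim (plane X v u s t)"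
  shows False
proof -
  note hr = hit_row[OF H] and hc = hit_col[OF H] and hs = hit_sym[OF H]
  note nr = slim_row[OF S] and nc = slim_col[OF S] and ns = slim_sym[OF S]
  note m4 = rows23_le[OF R]
  note F =
    nc[of v10 v01 T2 T0] ns[of v01 v10 T0 T1] nr[of v12 v01 T2 T2] ns[of v11 v01 T0 T1]
    nc[of v01 v10 T0 T2] ns[of v12 v01 T2 T2] nc[of v11 v01 T0 T2] ns[of v10 v01 T2 T2]
    nr[of v12 v01 T2 T1] ns[of v11 v01 T1 T1] nr[of v11 v01 T0 T0] ns[of v01 v10 T1 T1]
    ns[of v11 v01 T0 T2] nc[of v11 v01 T0 T0] nr[of v12 v01 T2 T0] ns[of v12 v01 T2 T0]
    nr[of v11 v01 T0 T1] nc[of v12 v01 T2 T0] nc[of v10 v01 T2 T2] nc[of v01 v10 T0 T1]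
    nc[of v01 v10 T1 T1] nr[of v11 v01 T1 T1] nc[of v12 v01 T2 T2] ns[of v12 v01 T2 T1]
    ns[of v01 v10 T0 T2] nr[of v10 v01 T2 T0] hr[of v10 v01 v02] hr[of v10 v01 v01] hc[of v11 v00 v12]
    hs[of v21 v02 v01] hs[of v11 v00 v11] hr[of v02 v10 v10] hr[of v10 v00 v02] hs[of v12 v01 v02]
    hr[of v12 v02 v01] hc[of v01 v00 v21] hr[of v02 v20 v10] hs[of v21 v01 v01] hr[of v11 v00 v02]
    hs[of v11 v01 v01] hc[of v10 v02 v02] hc[of v20 v02 v00] hc[of v01 v00 v11] hc[of v12 v01 v12]
    hs[of v02 v00 v10] hc[of v21 v02 v01] hc[of v10 v00 v11] hr[of v11 v02 v01] hr[of v21 v02 v00]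
    hr[of v12 v11 v02] hr[of v10 v02 v02] hs[of v02 v00 v20] hr[of v21 v02 v02] hr[of v12 v11 v00]
    hc[of v02 v10 v20] hr[of v22 v00 v02] hc[of v12 v02 v01] hs[of v10 v00 v10] m4[of v00 v01 v02 v21 v10]
    m4[of v00 v01 v21 v22 v10] m4[of v00 v02 v11 v22 v10] m4[of v00 v02 v12 v21 v10] m4[of v00 v02 v20 v21 v10]
    m4[of v00 v02 v20 v22 v10] m4[of v00 v02 v21 v22 v10] m4[of v00 v11 v20 v22 v10] m4[of v00 v12 v20 v21 v10]
    m4[of v00 v20 v21 v22 v10] m4[of v01 v02 v10 v11 v10] m4[of v01 v02 v10 v21 v10] m4[of v01 v10 v21 v22 v10]
    m4[of v02 v10 v11 v20 v10] m4[of v02 v10 v12 v21 v10] m4[of v02 v10 v20 v21 v10] m4[of v10 v11 v20 v22 v10]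
    m4[of v10 v12 v20 v21 v10] m4[of v10 v20 v21 v22 v10] m4[of v11 v12 v20 v21 v10] m4[of v02 v10 v21 v22 v20]
    m4[of v02 v11 v12 v20 v20] m4[of v00 v10 v21 v22 v11] m4[of v01 v02 v10 v20 v11]
  show False using F[unfolded cell_simps part_rows0a_def, simplified, simplified anchoredD[OF A], simplified] by argo
qed

definition "part_rows0b =
  [((v01,v10),T2,T0), ((v01,v10),T2,T1), ((v01,v10),T2,T2), ((v10,v01),T0,T2), ((v10,v01),T2,T1),
  ((v11,v01),T2,T0), ((v11,v01),T2,T2), ((v12,v01),T0,T0), ((v12,v01),T0,T1), ((v12,v01),T1,T1)]"

lemma region_rows0b:
  assumes H: "hit X" and A: "anchored T0 X" and R: "rows23 X"
    and S: "\<And>v u s t. ((v,u),s,t) \<in> set part_rows0b \<Longrightarrow> slim (plane X v u s t)"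
  shows False
proof -
  note hr = hit_row[OF H] and hc = hit_col[OF H] and hs = hit_sym[OF H]
  note nr = slim_row[OF S] and nc = slim_col[OF S] and ns = slim_sym[OF S]
  note m4 = rows23_le[OF R]
  note F =
    nr[of v12 v01 T0 T1] nc[of v10 v01 T0 T2] nr[of v01 v10 T2 T0] ns[of v12 v01 T0 T0]
    nr[of v12 v01 T1 T1] nr[of v12 v01 T0 T0] ns[of v11 v01 T2 T2] ns[of v12 v01 T1 T1]
    nr[of v01 v10 T2 T2] nr[of v01 v10 T2 T1] ns[of v10 v01 T2 T1] ns[of v01 v10 T2 T1]
    nr[of v10 v01 T2 T1] ns[of v01 v10 T2 T2] ns[of v12 v01 T0 T1] nc[of v10 v01 T2 T1]
    nc[of v11 v01 T2 T2] nr[of v11 v01 T2 T2] ns[of v10 v01 T0 T2] ns[of v11 v01 T2 T0]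
    nc[of v01 v10 T2 T1] ns[of v01 v10 T2 T0] nc[of v12 v01 T0 T0] nc[of v01 v10 T2 T2]
    nc[of v12 v01 T1 T1] nr[of v11 v01 T2 T0] nc[of v01 v10 T2 T0] hr[of v10 v00 v02] hc[of v12 v01 v02]
    hc[of v01 v00 v11] hs[of v12 v01 v02] hs[of v01 v20 v10] hs[of v21 v01 v01] hc[of v11 v01 v11]
    hs[of v02 v00 v10] hc[of v12 v00 v10] hs[of v02 v00 v20] hr[of v11 v02 v02] hr[of v11 v02 v00]
    hs[of v10 v00 v11] hr[of v22 v00 v02] hc[of v01 v00 v21] hc[of v12 v00 v12] hr[of v11 v10 v02]
    hr[of v20 v01 v01] hs[of v10 v00 v02] hr[of v02 v10 v10] hc[of v10 v02 v00] hs[of v20 v02 v01]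
    hr[of v22 v02 v01] hs[of v12 v00 v12] hs[of v11 v01 v11] hc[of v21 v01 v01] hc[of v22 v02 v00]
    hs[of v20 v00 v02] hs[of v22 v01 v02] hs[of v12 v00 v02] hc[of v01 v20 v00] hr[of v21 v02 v01]
    hr[of v20 v01 v02] hs[of v10 v02 v01] hc[of v20 v02 v01] m4[of v00 v01 v10 v12 v10] m4[of v00 v11 v12 v20 v10]
    m4[of v01 v10 v11 v12 v10] m4[of v01 v10 v12 v20 v10] m4[of v10 v11 v12 v21 v02] m4[of v10 v11 v20 v21 v02]
    m4[of v10 v11 v20 v22 v02] m4[of v10 v12 v20 v22 v02] m4[of v10 v12 v21 v22 v02] m4[of v11 v12 v21 v22 v02]
    m4[of v11 v20 v21 v22 v02] m4[of v01 v02 v11 v22 v12] m4[of v01 v11 v20 v22 v12]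
  show False using F[unfolded cell_simps part_rows0b_def, simplified, simplified anchoredD[OF A], simplified] by argo
qed

definition "part_rows0c =
  [((v10,v01),T1,T0)]"

lemma region_rows0c:
  assumes H: "hit X" and A: "anchored T0 X" and R: "rows23 X"
    and S: "\<And>v u s t. ((v,u),s,t) \<in> set part_rows0c \<Longrightarrow> slim (plane X v u s t)"
  shows False
proof -
  note nr = slim_row[OF S] and nc = slim_col[OF S] and ns = slim_sym[OF S]
  note F =
    nc[of v10 v01 T1 T0]
  show False using F[unfolded cell_simps part_rows0c_def, simplified, simplified anchoredD[OF A], simplified] by argo
qed

definition "part_rows0d =
  [((v10,v01),T0,T0), ((v10,v01),T0,T1), ((v11,v01),T1,T0), ((v11,v01),T1,T2), ((v12,v01),T1,T0),
  ((v12,v01),T1,T2)]"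

lemma region_rows0d:
  assumes H: "hit X" and A: "anchored T0 X" and R: "rows23 X"
    and S: "\<And>v u s t. ((v,u),s,t) \<in> set part_rows0d \<Longrightarrow> slim (plane X v u s t)"
  shows False
proof -
  note hr = hit_row[OF H] and hc = hit_col[OF H] and hs = hit_sym[OF H]
  note nr = slim_row[OF S] and nc = slim_col[OF S] and ns = slim_sym[OF S]
  note m4 = rows23_le[OF R]
  note F =
    nr[of v12 v01 T1 T2] nc[of v11 v01 T1 T0] ns[of v10 v01 T0 T0] nc[of v10 v01 T0 T1]
    nc[of v11 v01 T1 T2] nc[of v10 v01 T0 T0] nr[of v12 v01 T1 T0] ns[of v12 v01 T1 T0]
    nr[of v10 v01 T0 T0] ns[of v12 v01 T1 T2] nc[of v12 v01 T1 T0] nr[of v11 v01 T1 T2]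
    nc[of v12 v01 T1 T2] nr[of v11 v01 T1 T0] hs[of v22 v01 v02] hc[of v12 v01 v02] hs[of v11 v01 v11]
    hc[of v10 v00 v11] hs[of v12 v01 v12] hs[of v12 v01 v02] hc[of v12 v01 v12] hs[of v10 v00 v10]
    hc[of v10 v00 v10] hr[of v20 v00 v02] m4[of v00 v02 v10 v11 v20] m4[of v00 v10 v11 v12 v20]
    m4[of v00 v10 v12 v21 v20] m4[of v00 v10 v21 v22 v20]
  show False using F[unfolded cell_simps part_rows0d_def, simplified, simplified anchoredD[OF A], simplified] by argo
qed

definition "part_free0a =
  [((v10,v01),T1,T0)]"

lemma region_free0a:
  assumes H: "hit X" and A: "anchored T0 X"
    and S: "\<And>v u s t. ((v,u),s,t) \<in> set part_free0a \<Longrightarrow> slim (plane X v u s t)"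
  shows False
proof -
  note nr = slim_row[OF S] and nc = slim_col[OF S] and ns = slim_sym[OF S]
  note F =
    nc[of v10 v01 T1 T0]
  show False using F[unfolded cell_simps part_free0a_def, simplified, simplified anchoredD[OF A], simplified] by argo
qed

definition "part_free0b =
  [((v01,v10),T0,T1), ((v01,v10),T2,T0), ((v01,v10),T2,T1), ((v01,v10),T2,T2), ((v10,v01),T0,T1),
  ((v10,v01),T2,T0), ((v10,v01),T2,T2), ((v11,v01),T0,T0), ((v11,v01),T1,T0), ((v11,v01),T1,T1),
  ((v11,v01),T1,T2), ((v11,v01),T2,T0), ((v11,v01),T2,T1), ((v11,v01),T2,T2), ((v12,v01),T1,T0),
  ((v12,v01),T1,T1), ((v12,v01),T1,T2), ((v12,v01),T2,T0), ((v12,v01),T2,T1), ((v12,v01),T2,T2)]"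

lemma region_free0b:
  assumes H: "hit X" and A: "anchored T0 X"
    and S: "\<And>v u s t. ((v,u),s,t) \<in> set part_free0b \<Longrightarrow> slim (plane X v u s t)"
  shows False
proof -
  note hr = hit_row[OF H] and hc = hit_col[OF H] and hs = hit_sym[OF H]
  note nr = slim_row[OF S] and nc = slim_col[OF S] and ns = slim_sym[OF S]
  note F =
    nc[of v01 v10 T0 T1] nc[of v11 v01 T2 T2] nc[of v01 v10 T2 T2] ns[of v11 v01 T2 T0]
    nr[of v12 v01 T2 T2] nc[of v11 v01 T1 T0] nr[of v12 v01 T1 T0] ns[of v12 v01 T1 T1]
    nc[of v12 v01 T2 T2] ns[of v12 v01 T1 T0] ns[of v10 v01 T2 T2] nr[of v11 v01 T1 T2]
    ns[of v12 v01 T2 T2] ns[of v01 v10 T2 T2] nc[of v11 v01 T1 T2] nc[of v12 v01 T1 T0]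
    nr[of v11 v01 T2 T0] nr[of v12 v01 T1 T2] nr[of v10 v01 T0 T1] ns[of v11 v01 T2 T1]
    nc[of v12 v01 T1 T2] nc[of v01 v10 T2 T0] ns[of v12 v01 T2 T0] nc[of v12 v01 T2 T1]
    nr[of v10 v01 T2 T0] ns[of v11 v01 T1 T2] ns[of v12 v01 T1 T2] nc[of v11 v01 T2 T0]
    nr[of v12 v01 T1 T1] nc[of v11 v01 T0 T0] ns[of v11 v01 T1 T0] nc[of v11 v01 T1 T1]
    nr[of v01 v10 T2 T1] nr[of v11 v01 T1 T1] nc[of v12 v01 T1 T1] hc[of v21 v01 v01] hr[of v10 v12 v02]
    hr[of v10 v00 v02] hr[of v02 v20 v10] hs[of v10 v00 v10] hs[of v10 v00 v02] hs[of v21 v02 v02]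
    hc[of v01 v00 v11] hr[of v11 v02 v01] hc[of v01 v10 v21] hr[of v12 v12 v00] hs[of v10 v00 v11]
    hs[of v12 v01 v02] hr[of v01 v11 v20] hs[of v02 v00 v10] hs[of v01 v20 v01] hc[of v22 v02 v00]
    hc[of v01 v00 v21] hr[of v22 v00 v02] hc[of v10 v00 v11] hr[of v21 v00 v02] hc[of v20 v02 v01]
    hs[of v12 v00 v02] hc[of v11 v00 v12] hs[of v21 v01 v01] hs[of v11 v02 v10] hr[of v20 v00 v02]
  show False using F[unfolded cell_simps part_free0b_def, simplified, simplified anchoredD[OF A], simplified] by argo
qed

definition "part_rows1a =
  [((v01,v10),T1,T0), ((v10,v01),T1,T0), ((v10,v01),T1,T1), ((v11,v01),T1,T1), ((v12,v01),T0,T1),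
  ((v12,v01),T0,T2), ((v12,v01),T2,T0), ((v12,v01),T2,T2)]"

lemma region_rows1a:
  assumes H: "hit X" and A: "anchored T1 X" and R: "rows23 X"
    and S: "\<And>v u s t. ((v,u),s,t) \<in> set part_rows1a \<Longrightarrow> slim (plane X v u s t)"
  shows False
proof -
  note hr = hit_row[OF H] and hc = hit_col[OF H] and hs = hit_sym[OF H]
  note nr = slim_row[OF S] and nc = slim_col[OF S] and ns = slim_sym[OF S]
  note m4 = rows23_le[OF R]
  note F =
    nc[of v12 v01 T0 T2] nr[of v10 v01 T1 T1] nc[of v01 v10 T1 T0] nr[of v12 v01 T2 T0]
    ns[of v10 v01 T1 T0] ns[of v12 v01 T0 T2] ns[of v12 v01 T0 T1] nc[of v12 v01 T0 T1]
    nc[of v10 v01 T1 T0] nr[of v12 v01 T2 T2] ns[of v10 v01 T1 T1] nc[of v12 v01 T2 T2]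
    nr[of v12 v01 T0 T1] nc[of v11 v01 T1 T1] ns[of v01 v10 T1 T0] hr[of v10 v00 v02] hc[of v10 v01 v01]
    hr[of v10 v01 v02] hs[of v11 v01 v01] hr[of v11 v00 v02] hs[of v12 v00 v10] hr[of v02 v10 v00]
    hc[of v01 v00 v11] hr[of v20 v01 v02] hs[of v21 v02 v02] hs[of v10 v01 v01] hc[of v12 v00 v10]
    hs[of v10 v00 v11] hc[of v22 v02 v01] hr[of v11 v10 v02] hr[of v10 v11 v00] hs[of v12 v00 v12]
    m4[of v01 v02 v10 v11 v21] m4[of v01 v02 v10 v21 v21] m4[of v01 v10 v11 v12 v21] m4[of v01 v10 v12 v21 v21]
    m4[of v00 v10 v11 v12 v10] m4[of v00 v10 v11 v22 v10] m4[of v00 v11 v12 v20 v10] m4[of v00 v11 v12 v21 v10]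
    m4[of v00 v11 v20 v22 v10] m4[of v00 v11 v21 v22 v10] m4[of v10 v11 v12 v20 v10] m4[of v10 v11 v20 v22 v10]
    m4[of v11 v12 v20 v21 v10] m4[of v11 v20 v21 v22 v10] m4[of v00 v02 v11 v21 v11] m4[of v00 v11 v12 v21 v11]
    m4[of v00 v11 v21 v22 v11]
  show False using F[unfolded cell_simps part_rows1a_def, simplified, simplified anchoredD[OF A], simplified] by argo
qed

definition "part_rows1b =
  [((v01,v10),T1,T1), ((v01,v10),T1,T2), ((v01,v10),T2,T1), ((v01,v10),T2,T2), ((v10,v01),T0,T0),
  ((v10,v01),T0,T2), ((v11,v01),T0,T2), ((v11,v01),T2,T0), ((v11,v01),T2,T2), ((v12,v01),T0,T0),
  ((v12,v01),T2,T1)]"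

lemma region_rows1b:
  assumes H: "hit X" and A: "anchored T1 X" and R: "rows23 X"
    and S: "\<And>v u s t. ((v,u),s,t) \<in> set part_rows1b \<Longrightarrow> slim (plane X v u s t)"
  shows False
proof -
  note hr = hit_row[OF H] and hc = hit_col[OF H] and hs = hit_sym[OF H]
  note nr = slim_row[OF S] and nc = slim_col[OF S] and ns = slim_sym[OF S]
  note m4 = rows23_le[OF R]
  note F =
    nc[of v10 v01 T0 T0] nc[of v12 v01 T2 T1] nr[of v01 v10 T2 T1] ns[of v01 v10 T1 T1]
    nr[of v11 v01 T2 T2] nc[of v01 v10 T2 T2] nr[of v01 v10 T1 T1] ns[of v11 v01 T2 T0]
    nc[of v01 v10 T2 T1] nr[of v12 v01 T0 T0] ns[of v11 v01 T0 T2] ns[of v01 v10 T2 T1]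
    nc[of v12 v01 T0 T0] nc[of v11 v01 T2 T0] nr[of v10 v01 T0 T0] ns[of v10 v01 T0 T0]
    nr[of v11 v01 T2 T0] ns[of v01 v10 T1 T2] ns[of v11 v01 T2 T2] ns[of v12 v01 T2 T1]
    ns[of v10 v01 T0 T2] nc[of v01 v10 T1 T1] nc[of v11 v01 T0 T2] nc[of v11 v01 T2 T2]
    nr[of v01 v10 T2 T2] ns[of v01 v10 T2 T2] nr[of v12 v01 T2 T1] hs[of v01 v10 v11] hs[of v11 v01 v11]
    hr[of v21 v00 v02] hs[of v12 v02 v01] hs[of v10 v00 v10] hr[of v01 v10 v00] hs[of v11 v02 v02]
    hc[of v10 v01 v12] hr[of v11 v10 v00] hc[of v10 v00 v10] hs[of v12 v01 v02] hc[of v01 v10 v10]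
    hc[of v11 v02 v10] hs[of v02 v00 v10] hs[of v12 v00 v12] hc[of v11 v00 v10] hs[of v10 v01 v02]
    hc[of v11 v00 v11] hs[of v10 v01 v01] hr[of v22 v00 v02] hr[of v10 v00 v02] hs[of v01 v00 v20]
    hs[of v12 v02 v10] hc[of v10 v02 v12] hs[of v21 v02 v02] hr[of v20 v01 v02] hr[of v21 v01 v02]
    hr[of v01 v21 v10] hr[of v10 v01 v02] hc[of v12 v00 v10] hr[of v22 v01 v01] hr[of v12 v01 v02]
    hs[of v22 v02 v00] hr[of v22 v02 v02] hr[of v12 v11 v01] hr[of v11 v10 v02] hc[of v10 v00 v12]
    hc[of v12 v01 v11] hc[of v01 v20 v20] hc[of v10 v00 v11] hc[of v12 v02 v01] m4[of v01 v12 v20 v22 v10]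
    m4[of v01 v12 v21 v22 v10] m4[of v11 v12 v20 v21 v02] m4[of v00 v11 v21 v22 v11] m4[of v01 v11 v12 v21 v11]
  show False using F[unfolded cell_simps part_rows1b_def, simplified, simplified anchoredD[OF A], simplified] by argo
qed

definition "part_rows1c =
  [((v01,v10),T0,T1), ((v01,v10),T0,T2), ((v10,v01),T2,T0), ((v10,v01),T2,T1), ((v10,v01),T2,T2),
  ((v11,v01),T0,T1), ((v11,v01),T1,T0), ((v11,v01),T1,T2)]"

lemma region_rows1c:
  assumes H: "hit X" and A: "anchored T1 X" and R: "rows23 X"
    and S: "\<And>v u s t. ((v,u),s,t) \<in> set part_rows1c \<Longrightarrow> slim (plane X v u s t)"
  shows False
proof -
  note hr = hit_row[OF H] and hc = hit_col[OF H] and hs = hit_sym[OF H]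
  note nr = slim_row[OF S] and nc = slim_col[OF S] and ns = slim_sym[OF S]
  note m4 = rows23_le[OF R]
  note F =
    nc[of v10 v01 T2 T1] nc[of v10 v01 T2 T0] ns[of v11 v01 T1 T2] nr[of v10 v01 T2 T1]
    nc[of v11 v01 T1 T2] nr[of v10 v01 T2 T0] nc[of v01 v10 T0 T1] ns[of v10 v01 T2 T1]
    nc[of v10 v01 T2 T2] ns[of v11 v01 T0 T1] ns[of v01 v10 T0 T1] nr[of v10 v01 T2 T2]
    ns[of v10 v01 T2 T0] nr[of v11 v01 T1 T0] nr[of v11 v01 T0 T1] nc[of v01 v10 T0 T2]
    nc[of v11 v01 T0 T1] ns[of v01 v10 T0 T2] hs[of v11 v00 v12] hs[of v21 v02 v02] hr[of v02 v20 v00]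
    hs[of v11 v01 v11] hr[of v20 v00 v02] hr[of v11 v12 v02] hr[of v21 v02 v02] hr[of v10 v01 v02]
    hs[of v12 v02 v01] hr[of v12 v00 v02] hc[of v10 v02 v00] hs[of v12 v02 v12] hc[of v21 v02 v02]
    hr[of v12 v02 v00] hs[of v10 v02 v02] hc[of v12 v02 v01] hc[of v02 v00 v20] hr[of v11 v01 v01]
    hs[of v20 v02 v01] hr[of v22 v00 v02] hs[of v02 v00 v10] hc[of v11 v00 v12] hr[of v10 v02 v02]
    hr[of v10 v02 v01] hr[of v20 v02 v00] hc[of v01 v00 v11] hs[of v01 v00 v20] hr[of v21 v01 v02]
    hc[of v10 v02 v02] hr[of v11 v00 v02] m4[of v10 v11 v20 v22 v12] m4[of v01 v12 v20 v21 v20]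
    m4[of v00 v02 v11 v22 v22] m4[of v02 v10 v11 v22 v22] m4[of v00 v01 v02 v20 v11] m4[of v00 v02 v11 v22 v11]
    m4[of v00 v10 v11 v22 v11] m4[of v00 v10 v20 v22 v11] m4[of v00 v11 v21 v22 v11] m4[of v01 v02 v20 v21 v11]
    m4[of v01 v20 v21 v22 v11] m4[of v02 v11 v12 v22 v11] m4[of v02 v11 v21 v22 v11] m4[of v10 v11 v12 v22 v11]
    m4[of v10 v11 v21 v22 v11] m4[of v11 v12 v21 v22 v11]
  show False using F[unfolded cell_simps part_rows1c_def, simplified, simplified anchoredD[OF A], simplified] by argo
qed

definition "part_rows1d =
  [((v01,v10),T2,T0), ((v10,v01),T0,T1), ((v10,v01),T1,T2), ((v11,v01),T0,T0), ((v12,v01),T1,T0),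
  ((v12,v01),T1,T1), ((v12,v01),T1,T2)]"

lemma region_rows1d:
  assumes H: "hit X" and A: "anchored T1 X" and R: "rows23 X"
    and S: "\<And>v u s t. ((v,u),s,t) \<in> set part_rows1d \<Longrightarrow> slim (plane X v u s t)"
  shows False
proof -
  note hr = hit_row[OF H] and hc = hit_col[OF H] and hs = hit_sym[OF H]
  note nr = slim_row[OF S] and nc = slim_col[OF S] and ns = slim_sym[OF S]
  note m4 = rows23_le[OF R]
  note F =
    nc[of v01 v10 T2 T0] ns[of v12 v01 T1 T0] nc[of v12 v01 T1 T0] nr[of v11 v01 T0 T0]
    ns[of v01 v10 T2 T0] nc[of v12 v01 T1 T1] ns[of v10 v01 T1 T2] ns[of v11 v01 T0 T0]
    nr[of v12 v01 T1 T1] nr[of v10 v01 T0 T1] ns[of v12 v01 T1 T1] nc[of v12 v01 T1 T2]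
    nc[of v10 v01 T0 T1] hr[of v22 v00 v02] hc[of v20 v01 v02] hc[of v10 v00 v11] hc[of v11 v00 v10]
    hc[of v11 v00 v11] hs[of v10 v00 v11] hs[of v21 v01 v01] hs[of v22 v02 v01] hc[of v21 v01 v01]
    hc[of v11 v02 v01] hr[of v10 v00 v02] hs[of v11 v00 v12] hs[of v01 v00 v20] hr[of v10 v01 v02]
    hr[of v12 v10 v00] hs[of v02 v00 v10] hc[of v11 v00 v12] m4[of v10 v12 v20 v21 v02] m4[of v10 v12 v20 v22 v02]
    m4[of v11 v12 v20 v21 v02] m4[of v11 v12 v20 v22 v02] m4[of v01 v02 v10 v11 v10] m4[of v01 v02 v10 v21 v10]
    m4[of v01 v02 v10 v20 v11] m4[of v01 v02 v20 v21 v11]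
  show False using F[unfolded cell_simps part_rows1d_def, simplified, simplified anchoredD[OF A], simplified] by argo
qed

definition "part_free1a =
  [((v01,v10),T0,T1), ((v01,v10),T1,T1), ((v01,v10),T2,T1), ((v01,v10),T2,T2), ((v10,v01),T0,T0),
  ((v10,v01),T1,T1), ((v10,v01),T2,T0), ((v10,v01),T2,T1), ((v10,v01),T2,T2), ((v11,v01),T0,T1),
  ((v11,v01),T1,T0), ((v11,v01),T1,T1), ((v11,v01),T1,T2), ((v11,v01),T2,T0), ((v11,v01),T2,T2),
  ((v12,v01),T0,T0), ((v12,v01),T0,T1), ((v12,v01),T2,T0), ((v12,v01),T2,T1), ((v12,v01),T2,T2)]"

lemma region_free1a:
  assumes H: "hit X" and A: "anchored T1 X"
    and S: "\<And>v u s t. ((v,u),s,t) \<in> set part_free1a \<Longrightarrow> slim (plane X v u s t)"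
  shows False
proof -
  note hr = hit_row[OF H] and hc = hit_col[OF H] and hs = hit_sym[OF H]
  note nr = slim_row[OF S] and nc = slim_col[OF S] and ns = slim_sym[OF S]
  note F =
    nc[of v11 v01 T2 T0] nr[of v12 v01 T2 T0] ns[of v10 v01 T2 T0] nc[of v11 v01 T2 T2]
    ns[of v12 v01 T2 T1] nr[of v11 v01 T1 T0] nr[of v12 v01 T2 T2] ns[of v01 v10 T1 T1]
    ns[of v01 v10 T2 T1] ns[of v12 v01 T2 T0] nc[of v01 v10 T2 T2] nc[of v11 v01 T1 T1]
    nc[of v11 v01 T1 T0] nr[of v10 v01 T2 T2] nc[of v10 v01 T2 T1] ns[of v11 v01 T1 T0]
    nc[of v11 v01 T0 T1] ns[of v10 v01 T1 T1] nc[of v12 v01 T0 T1] ns[of v12 v01 T0 T1]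
    nr[of v12 v01 T0 T0] nc[of v12 v01 T2 T0] ns[of v11 v01 T1 T2] nr[of v12 v01 T0 T1]
    nc[of v10 v01 T2 T0] nc[of v01 v10 T0 T1] ns[of v01 v10 T2 T2] nr[of v10 v01 T0 T0]
    nc[of v11 v01 T1 T2] ns[of v01 v10 T0 T1] hs[of v02 v00 v10] hs[of v11 v01 v12] hc[of v12 v02 v01]
    hc[of v01 v20 v00] hc[of v10 v01 v01] hs[of v12 v00 v12] hc[of v12 v00 v02] hs[of v01 v00 v20]
    hr[of v12 v00 v02] hr[of v10 v02 v02] hs[of v01 v20 v01] hs[of v11 v00 v11] hs[of v12 v00 v10]
    hr[of v20 v02 v02] hc[of v10 v01 v12] hs[of v10 v00 v10] hr[of v01 v10 v20] hr[of v21 v02 v02]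
    hr[of v20 v00 v02] hr[of v12 v10 v02] hc[of v12 v00 v10] hr[of v11 v01 v01] hr[of v11 v12 v02]
    hs[of v10 v02 v02]
  show False using F[unfolded cell_simps part_free1a_def, simplified, simplified anchoredD[OF A], simplified] by argo
qed

definition "part_free1b =
  [((v01,v10),T1,T2), ((v10,v01),T0,T1), ((v10,v01),T1,T0), ((v11,v01),T0,T0), ((v12,v01),T1,T0),
  ((v12,v01),T1,T1), ((v12,v01),T1,T2)]"

lemma region_free1b:
  assumes H: "hit X" and A: "anchored T1 X"
    and S: "\<And>v u s t. ((v,u),s,t) \<in> set part_free1b \<Longrightarrow> slim (plane X v u s t)"
  shows False
proof -
  note hr = hit_row[OF H] and hc = hit_col[OF H] and hs = hit_sym[OF H]
  note nr = slim_row[OF S] and nc = slim_col[OF S] and ns = slim_sym[OF S]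
  note F =
    ns[of v11 v01 T0 T0] nc[of v12 v01 T1 T1] nc[of v10 v01 T1 T0] ns[of v12 v01 T1 T0]
    ns[of v10 v01 T1 T0] nc[of v10 v01 T0 T1] ns[of v12 v01 T1 T2] nr[of v10 v01 T0 T1]
    ns[of v12 v01 T1 T1] nr[of v01 v10 T1 T2] nr[of v12 v01 T1 T1] nc[of v12 v01 T1 T2]
    nr[of v11 v01 T0 T0] nc[of v12 v01 T1 T0] ns[of v01 v10 T1 T2] hc[of v02 v10 v20] hc[of v11 v00 v11]
    hc[of v11 v00 v10] hr[of v22 v00 v02] hr[of v10 v00 v02] hr[of v12 v10 v00] hc[of v21 v01 v01]
    hs[of v10 v00 v11] hs[of v01 v10 v20]
  show False using F[unfolded cell_simps part_free1b_def, simplified, simplified anchoredD[OF A], simplified] by argo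
qed

definition "part_rows2a =
  [((v10,v01),T0,T1), ((v10,v01),T1,T0), ((v10,v01),T1,T2), ((v11,v01),T2,T0), ((v11,v01),T2,T1),
  ((v12,v01),T2,T0)]"

lemma region_rows2a:
  assumes H: "hit X" and A: "anchored T2 X" and R: "rows23 X"
    and S: "\<And>v u s t. ((v,u),s,t) \<in> set part_rows2a \<Longrightarrow> slim (plane X v u s t)"
  shows False
proof -
  note hr = hit_row[OF H] and hc = hit_col[OF H] and hs = hit_sym[OF H]
  note nr = slim_row[OF S] and nc = slim_col[OF S] and ns = slim_sym[OF S]
  note m4 = rows23_le[OF R]
  note F =
    nc[of v11 v01 T2 T1] ns[of v10 v01 T1 T0] nr[of v11 v01 T2 T1] nc[of v10 v01 T1 T0]
    ns[of v10 v01 T1 T2] nr[of v11 v01 T2 T0] ns[of v11 v01 T2 T1] nc[of v12 v01 T2 T0]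
    ns[of v10 v01 T0 T1] ns[of v11 v01 T2 T0] nr[of v12 v01 T2 T0] nr[of v10 v01 T1 T2]
    ns[of v12 v01 T2 T0] nr[of v10 v01 T0 T1] hc[of v22 v02 v00] hc[of v11 v00 v12] hr[of v20 v00 v02]
    hc[of v11 v00 v11] hs[of v02 v00 v10] hc[of v01 v00 v20] hr[of v11 v00 v02] hs[of v01 v00 v21]
    hr[of v12 v01 v02] hs[of v21 v02 v01] hr[of v22 v00 v02] hr[of v22 v01 v01] hr[of v11 v10 v01]
    hr[of v20 v01 v01] hc[of v21 v02 v01] hs[of v10 v01 v02] hs[of v11 v02 v01] hc[of v10 v01 v02]
    hc[of v12 v02 v01] hc[of v21 v02 v00] hr[of v01 v20 v00] hc[of v10 v00 v11] hc[of v01 v00 v11]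
    hr[of v21 v00 v02] hc[of v10 v00 v10] hc[of v01 v20 v00] hr[of v10 v11 v00] hr[of v21 v02 v00]
    m4[of v10 v11 v20 v22 v02] m4[of v10 v11 v21 v22 v02] m4[of v10 v12 v20 v21 v02] m4[of v10 v12 v20 v22 v02]
    m4[of v10 v12 v21 v22 v02] m4[of v01 v02 v10 v12 v21] m4[of v01 v02 v10 v22 v21] m4[of v02 v10 v11 v22 v21]
    m4[of v02 v10 v12 v21 v21] m4[of v02 v10 v21 v22 v21] m4[of v00 v02 v10 v20 v20] m4[of v00 v10 v20 v22 v20]
    m4[of v01 v02 v10 v11 v20] m4[of v01 v02 v11 v20 v20] m4[of v01 v10 v11 v22 v20] m4[of v01 v11 v20 v22 v20]
    m4[of v02 v10 v12 v21 v20] m4[of v02 v10 v20 v21 v20] m4[of v02 v10 v20 v22 v20] m4[of v10 v20 v21 v22 v20]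
    m4[of v00 v02 v10 v12 v10] m4[of v02 v10 v12 v22 v10] m4[of v00 v02 v11 v12 v22] m4[of v00 v02 v11 v20 v22]
    m4[of v00 v02 v12 v22 v22] m4[of v00 v02 v20 v22 v22] m4[of v00 v10 v11 v12 v22] m4[of v00 v10 v11 v20 v22]
    m4[of v00 v10 v12 v22 v22] m4[of v00 v10 v20 v22 v22] m4[of v00 v11 v12 v21 v22] m4[of v00 v11 v20 v21 v22]
    m4[of v00 v12 v21 v22 v22] m4[of v00 v20 v21 v22 v22] m4[of v01 v02 v11 v12 v22] m4[of v01 v02 v11 v20 v22]
    m4[of v01 v02 v12 v22 v22] m4[of v01 v02 v20 v22 v22] m4[of v01 v10 v11 v12 v22] m4[of v01 v10 v11 v20 v22]
    m4[of v01 v10 v12 v22 v22] m4[of v01 v10 v20 v22 v22] m4[of v01 v11 v12 v21 v22] m4[of v01 v11 v20 v21 v22]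
    m4[of v01 v12 v21 v22 v22] m4[of v01 v20 v21 v22 v22] m4[of v00 v01 v02 v11 v11] m4[of v00 v01 v02 v12 v11]
    m4[of v00 v01 v11 v21 v11] m4[of v01 v02 v11 v21 v11]
  show False using F[unfolded cell_simps part_rows2a_def, simplified, simplified anchoredD[OF A], simplified] by argo
qed

definition "part_rows2b =
  [((v01,v10),T1,T1), ((v01,v10),T2,T0), ((v01,v10),T2,T2), ((v10,v01),T0,T2), ((v11,v01),T0,T1),
  ((v11,v01),T2,T2), ((v12,v01),T1,T0), ((v12,v01),T1,T1), ((v12,v01),T1,T2)]"

lemma region_rows2b:
  assumes H: "hit X" and A: "anchored T2 X" and R: "rows23 X"
    and S: "\<And>v u s t. ((v,u),s,t) \<in> set part_rows2b \<Longrightarrow> slim (plane X v u s t)"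
  shows False
proof -
  note hr = hit_row[OF H] and hc = hit_col[OF H] and hs = hit_sym[OF H]
  note nr = slim_row[OF S] and nc = slim_col[OF S] and ns = slim_sym[OF S]
  note m4 = rows23_le[OF R]
  note m2 = rows23_ge[OF R]
  note F =
    nc[of v12 v01 T1 T0] nr[of v01 v10 T2 T0] nr[of v11 v01 T2 T2] nc[of v01 v10 T2 T2]
    nr[of v11 v01 T0 T1] ns[of v12 v01 T1 T1] ns[of v12 v01 T1 T0] ns[of v12 v01 T1 T2]
    ns[of v10 v01 T0 T2] ns[of v01 v10 T2 T0] nc[of v12 v01 T1 T2] nc[of v12 v01 T1 T1]
    nr[of v01 v10 T1 T1] ns[of v01 v10 T1 T1] nr[of v12 v01 T1 T1] nc[of v01 v10 T1 T1]
    nc[of v11 v01 T0 T1] nc[of v11 v01 T2 T2] nr[of v01 v10 T2 T2] ns[of v01 v10 T2 T2]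
    nr[of v12 v01 T1 T0] hs[of v02 v20 v00] hs[of v10 v00 v10] hc[of v12 v01 v12] hs[of v11 v00 v11]
    hr[of v01 v11 v10] hr[of v02 v10 v20] hc[of v11 v00 v11] hc[of v22 v01 v02] hc[of v11 v00 v12]
    hs[of v12 v00 v12] hs[of v11 v00 v12] hs[of v12 v00 v11] hr[of v01 v10 v20] hs[of v01 v10 v11]
    hr[of v10 v00 v02] hr[of v21 v01 v02] hr[of v22 v01 v01] hc[of v10 v00 v12] hs[of v12 v01 v12]
    hc[of v10 v02 v00] hr[of v20 v00 v02] hr[of v22 v00 v02] hs[of v22 v00 v02] hr[of v01 v20 v20]
    hc[of v20 v00 v02] hr[of v12 v10 v01] hc[of v01 v20 v21] hc[of v10 v00 v11] hc[of v10 v00 v10]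
    hs[of v12 v00 v10] hr[of v12 v01 v02] hs[of v22 v02 v02] hs[of v11 v01 v12] hc[of v12 v01 v11]
    hs[of v10 v00 v11] m4[of v00 v01 v10 v12 v20] m4[of v00 v01 v10 v22 v20] m4[of v00 v01 v11 v22 v20]
    m4[of v00 v01 v21 v22 v20] m4[of v00 v10 v12 v21 v20] m4[of v01 v02 v10 v22 v20] m4[of v01 v02 v11 v20 v20]
    m4[of v01 v11 v12 v20 v20] m4[of v00 v01 v02 v20 v12] m4[of v00 v01 v02 v21 v12] m4[of v00 v01 v02 v22 v12]
    m4[of v00 v01 v11 v21 v12] m4[of v00 v02 v10 v20 v12] m4[of v00 v02 v10 v21 v12] m4[of v00 v02 v10 v22 v12]
    m4[of v00 v02 v12 v20 v12] m4[of v00 v02 v12 v21 v12] m4[of v00 v02 v12 v22 v12] m4[of v00 v11 v12 v21 v12]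
    m4[of v01 v02 v12 v20 v12] m4[of v01 v02 v12 v21 v12] m4[of v01 v02 v12 v22 v12] m4[of v00 v02 v11 v21 v10]
    m4[of v00 v01 v10 v20 v11] m4[of v00 v01 v20 v21 v11] m4[of v00 v01 v20 v22 v11] m4[of v00 v10 v12 v21 v11]
    m4[of v00 v10 v12 v22 v11] m4[of v01 v11 v20 v21 v11] m2[of v02 v22]
  show False using F[unfolded cell_simps part_rows2b_def, simplified, simplified anchoredD[OF A], simplified] by argo
qed

definition "part_rows2c =
  [((v01,v10),T1,T0), ((v01,v10),T1,T2), ((v10,v01),T0,T0), ((v10,v01),T1,T1), ((v11,v01),T1,T0),
  ((v11,v01),T1,T2), ((v12,v01),T0,T0), ((v12,v01),T0,T1)]"

lemma region_rows2c:
  assumes H: "hit X" and A: "anchored T2 X" and R: "rows23 X"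
    and S: "\<And>v u s t. ((v,u),s,t) \<in> set part_rows2c \<Longrightarrow> slim (plane X v u s t)"
  shows False
proof -
  note hr = hit_row[OF H] and hc = hit_col[OF H] and hs = hit_sym[OF H]
  note nr = slim_row[OF S] and nc = slim_col[OF S] and ns = slim_sym[OF S]
  note m4 = rows23_le[OF R]
  note F =
    nc[of v01 v10 T1 T0] ns[of v11 v01 T1 T0] nr[of v01 v10 T1 T0] nc[of v11 v01 T1 T0]
    ns[of v10 v01 T0 T0] nr[of v11 v01 T1 T2] nr[of v12 v01 T0 T1] nc[of v12 v01 T0 T0]
    ns[of v01 v10 T1 T2] nr[of v10 v01 T0 T0] nc[of v12 v01 T0 T1] nc[of v10 v01 T1 T1]
    nc[of v01 v10 T1 T2] hs[of v12 v00 v11] hs[of v22 v01 v02] hr[of v22 v01 v01] hr[of v20 v01 v01]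
    hs[of v12 v00 v10] hs[of v10 v01 v02] hr[of v12 v00 v02] hc[of v22 v01 v02] hs[of v12 v00 v12]
    hs[of v01 v10 v01] hc[of v10 v00 v10] hs[of v20 v01 v01] hc[of v12 v00 v12] hr[of v11 v12 v00]
    m4[of v01 v02 v21 v22 v12] m4[of v01 v12 v20 v22 v12] m4[of v00 v01 v02 v10 v20] m4[of v00 v01 v10 v21 v20]
    m4[of v00 v02 v10 v12 v20] m4[of v00 v10 v12 v21 v20] m4[of v00 v02 v11 v12 v21] m4[of v00 v11 v12 v20 v21]
  show False using F[unfolded cell_simps part_rows2c_def, simplified, simplified anchoredD[OF A], simplified] by argo
qed

definition "part_rows2d =
  [((v01,v10),T0,T1), ((v01,v10),T0,T2), ((v01,v10),T2,T1), ((v10,v01),T2,T0), ((v10,v01),T2,T1),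
  ((v10,v01),T2,T2), ((v11,v01),T0,T0), ((v11,v01),T0,T2), ((v11,v01),T1,T1), ((v12,v01),T0,T2),
  ((v12,v01),T2,T1), ((v12,v01),T2,T2)]"

lemma region_rows2d:
  assumes H: "hit X" and A: "anchored T2 X" and R: "rows23 X"
    and S: "\<And>v u s t. ((v,u),s,t) \<in> set part_rows2d \<Longrightarrow> slim (plane X v u s t)"
  shows False
proof -
  note hr = hit_row[OF H] and hc = hit_col[OF H] and hs = hit_sym[OF H]
  note nr = slim_row[OF S] and nc = slim_col[OF S] and ns = slim_sym[OF S]
  note m4 = rows23_le[OF R]
  note F =
    nc[of v01 v10 T0 T2] nr[of v01 v10 T2 T1] nc[of v12 v01 T0 T2] ns[of v12 v01 T2 T2]
    nr[of v10 v01 T2 T2] nr[of v12 v01 T2 T2] ns[of v10 v01 T2 T0] nc[of v11 v01 T0 T0]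
    ns[of v10 v01 T2 T2] nc[of v01 v10 T2 T1] nr[of v12 v01 T2 T1] ns[of v10 v01 T2 T1]
    ns[of v11 v01 T0 T2] nr[of v10 v01 T2 T1] ns[of v12 v01 T2 T1] ns[of v01 v10 T2 T1]
    nc[of v10 v01 T2 T1] nc[of v10 v01 T2 T0] ns[of v01 v10 T0 T1] nr[of v10 v01 T2 T0]
    nc[of v01 v10 T0 T1] ns[of v01 v10 T0 T2] nc[of v11 v01 T0 T2] ns[of v11 v01 T1 T1]
    nc[of v12 v01 T2 T2] nc[of v12 v01 T2 T1] nc[of v10 v01 T2 T2] nr[of v11 v01 T0 T0]
    ns[of v11 v01 T0 T0] nc[of v11 v01 T1 T1] hc[of v10 v01 v01] hc[of v21 v00 v02] hs[of v10 v01 v02]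
    hs[of v11 v01 v12] hr[of v10 v01 v01] hr[of v11 v01 v01] hr[of v21 v00 v02] hs[of v11 v00 v02]
    hr[of v20 v02 v00] hc[of v21 v02 v01] hr[of v02 v20 v00] hs[of v21 v02 v01] hs[of v11 v00 v11]
    hc[of v01 v00 v11] hs[of v01 v00 v21] hs[of v01 v20 v10] hs[of v02 v00 v10] hc[of v12 v02 v01]
    hc[of v12 v00 v10] hc[of v11 v00 v02] hc[of v22 v01 v02] hs[of v11 v01 v01] hr[of v01 v11 v00]
    hr[of v01 v21 v00] hr[of v22 v00 v02] hr[of v21 v02 v00] hr[of v12 v11 v02] hr[of v21 v01 v02]
    hs[of v22 v01 v01] hr[of v01 v11 v20] hr[of v02 v20 v10] hc[of v01 v00 v20] hr[of v10 v02 v02]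
    hr[of v20 v01 v01] hc[of v11 v00 v11] hs[of v10 v02 v00] hr[of v12 v12 v00] hr[of v20 v00 v02]
    hs[of v22 v01 v02] hr[of v22 v02 v02] hs[of v12 v00 v02] hc[of v11 v00 v12] hr[of v01 v20 v00]
    hr[of v11 v00 v02] hc[of v10 v02 v12] hc[of v22 v01 v01] hr[of v11 v12 v00] hr[of v12 v00 v02]
    hr[of v12 v02 v01] m4[of v00 v01 v10 v20 v21] m4[of v00 v11 v12 v22 v21] m4[of v00 v12 v20 v21 v21]
    m4[of v00 v20 v21 v22 v21] m4[of v01 v02 v10 v22 v21] m4[of v01 v02 v12 v22 v21] m4[of v01 v10 v20 v21 v21]
    m4[of v01 v10 v20 v22 v21] m4[of v01 v11 v12 v22 v21] m4[of v01 v12 v20 v21 v21] m4[of v01 v12 v20 v22 v21]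
    m4[of v01 v20 v21 v22 v21] m4[of v02 v10 v21 v22 v21] m4[of v02 v11 v12 v22 v21] m4[of v02 v12 v21 v22 v21]
    m4[of v10 v20 v21 v22 v21] m4[of v11 v12 v20 v22 v21] m4[of v11 v12 v21 v22 v21] m4[of v12 v20 v21 v22 v21]
    m4[of v00 v01 v10 v12 v20] m4[of v00 v10 v12 v20 v20] m4[of v00 v10 v12 v21 v20] m4[of v00 v10 v20 v22 v20]
    m4[of v10 v12 v20 v21 v20] m4[of v10 v12 v21 v22 v20] m4[of v10 v20 v21 v22 v20] m4[of v00 v02 v21 v22 v11]
    m4[of v00 v10 v21 v22 v11] m4[of v00 v12 v21 v22 v11] m4[of v00 v20 v21 v22 v11] m4[of v01 v11 v12 v21 v11]
  show False using F[unfolded cell_simps part_rows2d_def, simplified, simplified anchoredD[OF A], simplified] by argo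
qed

definition "part_free2a =
  [((v01,v10),T0,T1), ((v01,v10),T0,T2), ((v01,v10),T1,T0), ((v01,v10),T1,T2), ((v01,v10),T2,T1),
  ((v01,v10),T2,T2), ((v10,v01),T0,T0), ((v10,v01),T0,T1), ((v10,v01),T0,T2), ((v10,v01),T1,T2),
  ((v10,v01),T2,T0), ((v10,v01),T2,T1), ((v10,v01),T2,T2), ((v11,v01),T0,T0), ((v11,v01),T0,T1),
  ((v11,v01),T0,T2), ((v11,v01),T1,T2), ((v11,v01),T2,T2), ((v12,v01),T0,T0), ((v12,v01),T1,T0),
  ((v12,v01),T1,T1), ((v12,v01),T1,T2)]"

lemma region_free2a:
  assumes H: "hit X" and A: "anchored T2 X"
    and S: "\<And>v u s t. ((v,u),s,t) \<in> set part_free2a \<Longrightarrow> slim (plane X v u s t)"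
  shows False
proof -
  note hr = hit_row[OF H] and hc = hit_col[OF H] and hs = hit_sym[OF H]
  note nr = slim_row[OF S] and nc = slim_col[OF S] and ns = slim_sym[OF S]
  note F =
    ns[of v11 v01 T0 T2] nc[of v10 v01 T1 T2] nc[of v10 v01 T2 T0] nr[of v10 v01 T2 T0]
    ns[of v01 v10 T0 T1] nr[of v01 v10 T1 T0] nc[of v01 v10 T2 T1] nr[of v10 v01 T0 T0]
    nc[of v10 v01 T0 T2] nr[of v01 v10 T2 T2] nr[of v10 v01 T0 T1] ns[of v12 v01 T1 T2]
    ns[of v12 v01 T1 T1] ns[of v01 v10 T2 T2] nr[of v12 v01 T1 T0] ns[of v11 v01 T0 T0]
    nr[of v11 v01 T2 T2] ns[of v11 v01 T0 T1] nc[of v12 v01 T1 T0] ns[of v01 v10 T0 T2]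
    nc[of v12 v01 T0 T0] nr[of v12 v01 T0 T0] ns[of v01 v10 T1 T2] nr[of v11 v01 T0 T1]
    ns[of v11 v01 T2 T2] nr[of v11 v01 T1 T2] nr[of v12 v01 T1 T1] nr[of v11 v01 T0 T0]
    nc[of v01 v10 T0 T1] ns[of v10 v01 T2 T1] nc[of v01 v10 T0 T2] nc[of v11 v01 T0 T0]
    nc[of v12 v01 T1 T1] nc[of v11 v01 T2 T2] nc[of v10 v01 T2 T2] ns[of v10 v01 T0 T2]
    nc[of v01 v10 T1 T2] nc[of v10 v01 T0 T0] hs[of v12 v02 v01] hs[of v20 v02 v02] hs[of v20 v02 v00]
    hc[of v12 v02 v00] hs[of v10 v02 v00] hr[of v22 v02 v02] hr[of v21 v01 v02] hc[of v10 v02 v00]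
    hs[of v11 v00 v11] hc[of v21 v02 v00] hc[of v11 v00 v11] hr[of v10 v00 v02] hc[of v12 v01 v11]
    hc[of v10 v00 v10] hc[of v01 v00 v20] hc[of v21 v00 v02] hc[of v01 v00 v11] hc[of v22 v02 v02]
    hs[of v12 v01 v02] hc[of v02 v10 v10] hs[of v02 v00 v10] hr[of v21 v02 v01] hs[of v01 v10 v20]
    hr[of v20 v02 v01] hr[of v02 v10 v20] hc[of v12 v00 v12] hr[of v12 v10 v01] hc[of v11 v00 v12]
    hr[of v10 v01 v01] hr[of v20 v02 v00]
  show False using F[unfolded cell_simps part_free2a_def, simplified, simplified anchoredD[OF A], simplified] by argo
qed

definition "part_free2b =
  [((v10,v01),T1,T0), ((v11,v01),T1,T0), ((v12,v01),T0,T1), ((v12,v01),T2,T0), ((v12,v01),T2,T2)]"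

lemma region_free2b:
  assumes H: "hit X" and A: "anchored T2 X"
    and S: "\<And>v u s t. ((v,u),s,t) \<in> set part_free2b \<Longrightarrow> slim (plane X v u s t)"
  shows False
proof -
  note hr = hit_row[OF H] and hc = hit_col[OF H] and hs = hit_sym[OF H]
  note nr = slim_row[OF S] and nc = slim_col[OF S] and ns = slim_sym[OF S]
  note F =
    ns[of v10 v01 T1 T0] nc[of v10 v01 T1 T0] nr[of v12 v01 T2 T0] nc[of v12 v01 T2 T0]
    ns[of v11 v01 T1 T0] nr[of v12 v01 T2 T2] ns[of v12 v01 T2 T0] nr[of v12 v01 T0 T1]
    nc[of v12 v01 T2 T2] nc[of v11 v01 T1 T0] hr[of v10 v11 v00] hc[of v01 v00 v11] hc[of v01 v00 v20]
    hr[of v20 v00 v02] hr[of v11 v00 v02] hr[of v11 v12 v00]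
  show False using F[unfolded cell_simps part_free2b_def, simplified, simplified anchoredD[OF A], simplified] by argo
qed

section \<open>No hitting set of 23 cells\<close>

text \<open>The square sum 61 is attained only if all terms \<open>(n - 2) * (n - 3)\<close> vanish.\<close>

lemma rows23_iff:
  assumes "cell_count X = 23"
  shows "rows23 X \<longleftrightarrow> sqsum (rowc X) = 61"
proof -
  have gap0: "(n - 2) * (n - 3) = 0 \<longleftrightarrow> n = 2 \<or> n = 3" for n :: int by auto
  have "sqsum (rowc X) = 61 \<longleftrightarrow> (\<Sum>i\<in>UNIV. (rowc X i - 2) * (rowc X i - 3)) = 0"
    using sum_gap[of "rowc X"] assms by (simp add: cell_count_def)
  also have "\<dots> \<longleftrightarrow> (\<forall>i. (rowc X i - 2) * (rowc X i - 3) = 0)"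
    by (subst sum_nonneg_eq_0_iff) (auto intro: gap_nonneg)
  also have "\<dots> \<longleftrightarrow> rows23 X"
    unfolding gap0 rows23_def rowc_card by (intro iff_allI) auto
  finally show ?thesis ..
qed

text \<open>Disjoint lists that all meet \<open>B\<close> provide that many elements of \<open>B\<close>.\<close>

lemma parts_le_card:
  assumes "finite B" "distinct (concat ps)" "\<And>p. p \<in> set ps \<Longrightarrow> \<exists>x\<in>set p. x \<in> B"
  shows "length ps \<le> card B"
  using assms
proof (induction ps arbitrary: B)
  case (Cons p ps)
  have "\<exists>x\<in>set q. x \<in> B - set p" if q: "q \<in> set ps" for q
  proof -
    from Cons.prems(3)[of q] q obtain x where x: "x \<in> set q" "x \<in> B" by auto
    with Cons.prems(2) q have "x \<notin> set p" by auto
    with x show ?thesis by blast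
  qed
  with Cons.IH[of "B - set p"] Cons.prems(1,2) have "length ps \<le> card (B - set p)" by simp
  moreover from Cons.prems(3)[of p] obtain x where "x \<in> set p" "x \<in> B" by auto
  then have "card (B - set p) < card B" by (intro psubset_card_mono[OF Cons.prems(1)]) auto
  ultimately show ?case by simp
qed simp

lemma part_meets_fat:
  assumes "(\<And>v u s t. ((v, u), s, t) \<in> set p \<Longrightarrow> slim (plane X v u s t)) \<Longrightarrow> False"
    and "\<forall>x\<in>set p. fst x \<in> set frames"
  shows "\<exists>x\<in>set p. x \<in> fat X"
proof (rule ccontr)
  assume no: "\<not> ?thesis"
  have "slim (plane X v u s t)" if "((v, u), s, t) \<in> set p" for v u s t
    using no assms(2) that by (force simp: fat_def)
  then show False by (rule assms(1))
qed

lemmas part_defs = part_rows0a_def part_rows0b_def part_rows0c_def part_rows0d_def part_free0a_def part_free0b_def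
  part_rows1a_def part_rows1b_def part_rows1c_def part_rows1d_def part_free1a_def part_free1b_def
  part_rows2a_def part_rows2b_def part_rows2c_def part_rows2d_def part_free2a_def part_free2b_def

lemma distinct_parts:
  shows "distinct (concat [part_rows0a, part_rows0b, part_rows0c, part_rows0d])"
  and "distinct (concat [part_rows1a, part_rows1b, part_rows1c, part_rows1d])"
  and "distinct (concat [part_rows2a, part_rows2b, part_rows2c, part_rows2d])"
  and "distinct (concat [part_free0a, part_free0b])"
  and "distinct (concat [part_free1a, part_free1b])"
  and "distinct (concat [part_free2a, part_free2b])"
  by (simp_all add: part_defs)

lemma anchored_fat_rows:
  assumes H: "hit X" and A: "anchored \<beta> X" and R: "rows23 X"
  shows "4 \<le> card (fat X)"
proof (cases \<beta>)
  case T0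
  note A' = A[unfolded T0]
  have a: "\<exists>x\<in>set part_rows0a. x \<in> fat X"
    by (rule part_meets_fat) (use region_rows0a[OF H A' R] in blast, simp add: part_defs frames_def)
  have b: "\<exists>x\<in>set part_rows0b. x \<in> fat X"
    by (rule part_meets_fat) (use region_rows0b[OF H A' R] in blast, simp add: part_defs frames_def)
  have c: "\<exists>x\<in>set part_rows0c. x \<in> fat X"
    by (rule part_meets_fat) (use region_rows0c[OF H A' R] in blast, simp add: part_defs frames_def)
  have d: "\<exists>x\<in>set part_rows0d. x \<in> fat X"
    by (rule part_meets_fat) (use region_rows0d[OF H A' R] in blast, simp add: part_defs frames_def)
  have "length [part_rows0a, part_rows0b, part_rows0c, part_rows0d] \<le> card (fat X)"
    by (rule parts_le_card[OF finite_fat]) (use a b c d distinct_parts in auto)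
  then show ?thesis by simp
next
  case T1
  note A' = A[unfolded T1]
  have a: "\<exists>x\<in>set part_rows1a. x \<in> fat X"
    by (rule part_meets_fat) (use region_rows1a[OF H A' R] in blast, simp add: part_defs frames_def)
  have b: "\<exists>x\<in>set part_rows1b. x \<in> fat X"
    by (rule part_meets_fat) (use region_rows1b[OF H A' R] in blast, simp add: part_defs frames_def)
  have c: "\<exists>x\<in>set part_rows1c. x \<in> fat X"
    by (rule part_meets_fat) (use region_rows1c[OF H A' R] in blast, simp add: part_defs frames_def)
  have d: "\<exists>x\<in>set part_rows1d. x \<in> fat X"
    by (rule part_meets_fat) (use region_rows1d[OF H A' R] in blast, simp add: part_defs frames_def)
  have "length [part_rows1a, part_rows1b, part_rows1c, part_rows1d] \<le> card (fat X)"
    by (rule parts_le_card[OF finite_fat]) (use a b c d distinct_parts in auto)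
  then show ?thesis by simp
next
  case T2
  note A' = A[unfolded T2]
  have a: "\<exists>x\<in>set part_rows2a. x \<in> fat X"
    by (rule part_meets_fat) (use region_rows2a[OF H A' R] in blast, simp add: part_defs frames_def)
  have b: "\<exists>x\<in>set part_rows2b. x \<in> fat X"
    by (rule part_meets_fat) (use region_rows2b[OF H A' R] in blast, simp add: part_defs frames_def)
  have c: "\<exists>x\<in>set part_rows2c. x \<in> fat X"
    by (rule part_meets_fat) (use region_rows2c[OF H A' R] in blast, simp add: part_defs frames_def)
  have d: "\<exists>x\<in>set part_rows2d. x \<in> fat X"
    by (rule part_meets_fat) (use region_rows2d[OF H A' R] in blast, simp add: part_defs frames_def)
  have "length [part_rows2a, part_rows2b, part_rows2c, part_rows2d] \<le> card (fat X)"
    by (rule parts_le_card[OF finite_fat]) (use a b c d distinct_parts in auto)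
  then show ?thesis by simp
qed

lemma anchored_fat_free:
  assumes H: "hit X" and A: "anchored \<beta> X"
  shows "2 \<le> card (fat X)"
proof (cases \<beta>)
  case T0
  note A' = A[unfolded T0]
  have a: "\<exists>x\<in>set part_free0a. x \<in> fat X"
    by (rule part_meets_fat) (use region_free0a[OF H A'] in blast, simp add: part_defs frames_def)
  have b: "\<exists>x\<in>set part_free0b. x \<in> fat X"
    by (rule part_meets_fat) (use region_free0b[OF H A'] in blast, simp add: part_defs frames_def)
  have "length [part_free0a, part_free0b] \<le> card (fat X)"
    by (rule parts_le_card[OF finite_fat]) (use a b distinct_parts in auto)
  then show ?thesis by simp
next
  case T1
  note A' = A[unfolded T1]
  have a: "\<exists>x\<in>set part_free1a. x \<in> fat X"
    by (rule part_meets_fat) (use region_free1a[OF H A'] in blast, simp add: part_defs frames_def)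
  have b: "\<exists>x\<in>set part_free1b. x \<in> fat X"
    by (rule part_meets_fat) (use region_free1b[OF H A'] in blast, simp add: part_defs frames_def)
  have "length [part_free1a, part_free1b] \<le> card (fat X)"
    by (rule parts_le_card[OF finite_fat]) (use a b distinct_parts in auto)
  then show ?thesis by simp
next
  case T2
  note A' = A[unfolded T2]
  have a: "\<exists>x\<in>set part_free2a. x \<in> fat X"
    by (rule part_meets_fat) (use region_free2a[OF H A'] in blast, simp add: part_defs frames_def)
  have b: "\<exists>x\<in>set part_free2b. x \<in> fat X"
    by (rule part_meets_fat) (use region_free2b[OF H A'] in blast, simp add: part_defs frames_def)
  have "length [part_free2a, part_free2b] \<le> card (fat X)"
    by (rule parts_le_card[OF finite_fat]) (use a b distinct_parts in auto)
  then show ?thesis by simp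
qed

text \<open>A partner row has at least three cells. With exactly three, the normal form would exist, and the number of
  planes that are not slim would exceed the bound of \<open>profile\<close>, which is invariant under the change of
  coordinates.\<close>

lemma partner_large:
  assumes H: "hit X" and T: "cell_count X = 23"
    and le: "sqsum (rowc X) \<le> sqsum (colc X)" "sqsum (rowc X) \<le> sqsum (symc X)"
    and G: "good_row X i f s a t"
  shows "\<exists>e. 4 \<le> card {j. X (s \<odot> snd f + e \<odot> fst f) j}"
proof -
  obtain j0 v k where v: "v \<noteq> 0" and k: "k = i + v" and ex: "\<exists>e. k = s \<odot> snd f + e \<odot> fst f"
    and row: "\<And>j. X i j \<longleftrightarrow> j = j0 \<or> j = j0 + v" and kk: "X k j0"
    and l: "\<not> X (i - v) j0" "\<not> X (i - v) (j0 + v)" "\<not> X (i - v) (j0 - v)"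
    by (rule slim_partner[OF H G]) (rule that)
  from ex obtain e where e: "k = s \<odot> snd f + e \<odot> fst f" by blast
  obtain w \<beta> where w: "w \<noteq> 0" "w \<noteq> v" "w \<noteq> - v" "X k (j0 + w)" "X k (j0 + (- w + \<beta> \<odot> v))"
    using partner_cells[OF H v row] unfolding k by blast
  have "card {j0, j0 + w, j0 + (- w + \<beta> \<odot> v)} \<le> card {j. X k j}"
    using w(4,5) kk by (intro card_mono) auto
  then have ge: "3 \<le> card {j. X k j}" using partner_distinct[OF v w(1-3)] by simp
  have "card {j. X k j} \<noteq> 3"
  proof
    assume "card {j. X k j} = 3"
    from anchored_move[OF H v k row kk l this] obtain g \<beta> where
      g: "bij g" "\<And>x y. g (x + y) = g x + g y" and A: "anchored \<beta> (move i j0 g X)" by blast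
    let ?Z = "move i j0 g X"
    have Z: "hit ?Z" "cell_count ?Z = 23" using hit_move[OF g(2,1) H] cell_count_move[OF g(2,1)] T by simp_all
    have "sqsum (rowc ?Z) \<le> sqsum (colc ?Z)" "sqsum (rowc ?Z) \<le> sqsum (symc ?Z)"
      using le unfolding sqsum_move[OF g(2,1)] .
    from profile[OF Z this] show False
      using anchored_fat_rows[OF Z(1) A] anchored_fat_free[OF Z(1) A] rows23_iff[OF Z(2)] by auto
  qed
  with ge e show ?thesis by (intro exI[of _ e]) simp
qed

text \<open>Nine rows with three cells each would have 27 cells, four more than there are.\<close>

lemma card_pairs:
  assumes "cell_count X = 23" and "\<And>i. i \<notin> E \<Longrightarrow> card {j. X i j} = 2 \<or> card {j. X i j} = 3"
    and "\<And>i. i \<in> E \<Longrightarrow> card {j. X i j} \<noteq> 2"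
  shows "int (card {i. card {j. X i j} = 2}) = 4 + (\<Sum>i\<in>E. rowc X i - 3)"
proof -
  have "27 - 23 = (\<Sum>i\<in>UNIV. 3 - rowc X i)"
    using assms(1) by (simp add: sum_subtractf cell_count_def card_vec)
  also have "\<dots> = (\<Sum>i\<in>UNIV. of_bool (card {j. X i j} = 2) - (if i \<in> E then rowc X i - 3 else 0))"
    using assms(2,3) by (intro sum.cong refl) (auto simp: rowc_card)
  also have "\<dots> = int (card {i. card {j. X i j} = 2}) - (\<Sum>i\<in>E. rowc X i - 3)"
    by (simp add: sum_subtractf sum.If_cases)
  finally show ?thesis by simp
qed

text \<open>If all rows have two or three cells, four of them have two, more than there are planes that are not
  slim, and \<open>partner_large\<close> is violated. Otherwise there is one exceptional row \<open>i0\<close> with one or four cells.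
  The first case is excluded in the same way. In the second, all five rows with two cells have slim planes,
  so all have the partner \<open>i0\<close>; but only four directions lead away from \<open>i0\<close>, and each accounts for
  at most one of these rows.\<close>

lemma no_hitting_set_of_23:
  assumes H: "hit X" and T: "cell_count X = 23"
    and le: "sqsum (rowc X) \<le> sqsum (colc X)" "sqsum (rowc X) \<le> sqsum (symc X)"
  shows False
proof -
  let ?A = "{i. card {j. X i j} = 2}" and ?G = "{i. \<exists>f s a t. good_row X i f s a t}"
  note many = many_good[OF H]
  note large = partner_large[OF H T le]
  from profile[OF H T le] show False
  proof (elim disjE conjE)
    assume "sqsum (rowc X) = 61" and b: "card (fat X) \<le> 3"
    then have r: "card {j. X i j} = 2 \<or> card {j. X i j} = 3" for i
      using rows23_iff[OF T] unfolding rows23_def by blast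
    then have "card ?A = 4" using card_pairs[OF T, of "{}"] by simp
    with many b have "card ?G \<noteq> 0" by linarith
    then have "?G \<noteq> {}" by (metis card.empty)
    then obtain i f s a t where "good_row X i f s a t" by blast
    from large[OF this] obtain k where "4 \<le> card {j. X k j}" by blast
    with r[of k] show False by auto
  next
    assume R: "sqsum (rowc X) = 63" and b: "int (card (fat X)) \<le> excess X" and ex: "excess X \<le> 1"
    let ?h = "\<lambda>i. (rowc X i - 2) * (rowc X i - 3)"
    have sum2: "(\<Sum>i\<in>UNIV. ?h i) = 2" using sum_gap[of "rowc X"] T R by (simp add: cell_count_def)
    have "\<exists>i0. ?h i0 \<noteq> 0"
    proof (rule ccontr)
      assume "\<nexists>i0. ?h i0 \<noteq> 0"
      then have "(\<Sum>i\<in>UNIV. ?h i) = 0" by (intro sum.neutral) blast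
      with sum2 show False by simp
    qed
    then obtain i0 where i0: "?h i0 \<noteq> 0" ..
    have split: "?h i0 + (\<Sum>i\<in>UNIV - {i0}. ?h i) = 2"
      using sum2 sum.remove[of UNIV i0 ?h] by (simp only: finite UNIV_I)
    have "even (?h i0)" by auto
    then obtain m where m: "?h i0 = 2 * m" by (rule evenE)
    have "2 \<le> ?h i0" using i0 gap_nonneg[of "rowc X i0"] unfolding m by presburger
    moreover have "0 \<le> (\<Sum>i\<in>UNIV - {i0}. ?h i)" by (intro sum_nonneg gap_nonneg)
    ultimately have h0: "?h i0 = 2" and "(\<Sum>i\<in>UNIV - {i0}. ?h i) = 0" using split by linarith+
    then have "\<forall>i\<in>UNIV - {i0}. ?h i = 0" by (subst (asm) sum_nonneg_eq_0_iff) (auto intro: gap_nonneg)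
    then have others: "card {j. X i j} = 2 \<or> card {j. X i j} = 3" if "i \<noteq> i0" for i
      using that by (auto simp: rowc_card)
    have "(rowc X i0 - 1) * (rowc X i0 - 4) = 0" using h0 by (simp add: algebra_simps)
    then have r0: "card {j. X i0 j} = 1 \<or> card {j. X i0 j} = 4" by (auto simp: rowc_card)
    have cardA: "int (card ?A) = 1 + rowc X i0" 
      using card_pairs[OF T, of "{i0}"] others r0 by auto
    have four: "s \<odot> snd f + e \<odot> fst f = i0 \<and> card {j. X i0 j} = 4"
      if "4 \<le> card {j. X (s \<odot> snd f + e \<odot> fst f) j}" for s e f
      using that others[of "s \<odot> snd f + e \<odot> fst f"] r0 by (cases "s \<odot> snd f + e \<odot> fst f = i0") auto
    have "card ?A \<le> 1 + card ?G" using many b ex by linarith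
    moreover have "2 \<le> card ?A" using cardA r0 by (auto simp: rowc_card)
    ultimately have "card ?G \<noteq> 0" by linarith
    then have "?G \<noteq> {}" by (metis card.empty)
    then obtain i f s a t where "good_row X i f s a t" by blast
    from large[OF this] four have r4: "card {j. X i0 j} = 4" by blast
    \<comment> \<open>A plane that is not slim would be the only one and hence have at least six cells. With two cells in each of the two parallel planes, its three rows would have at least ten cells, but they have at most \<open>2 + 3 + 4\<close>.\<close>
    have "?A \<subseteq> ?G"
    proof
      fix i assume "i \<in> ?A"
      then have c2: "card {j. X i j} = 2" by simp
      then obtain f s a t where P: "pair_row X i f s a t" by (rule pair_rowE)
      obtain v u where f: "f = (v, u)" by (cases f)
      have F: "(v, u) \<in> set frames" and i: "i = s \<odot> u + a \<odot> v" using P by (auto simp: pair_row_def f)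
      have "slim (plane X v u s t)"
      proof (rule ccontr)
        assume ns: "\<not> slim (plane X v u s t)"
        then have inb: "((v, u), s, t) \<in> fat X" using F by (simp add: fat_def)
        then have "card (fat X) \<noteq> 0" using finite_fat by auto
        then have c1: "card (fat X) = 1" and e1: "excess X = 1" using b ex by linarith+
        have "\<exists>f'\<in>set frames. \<exists>s' t'. surplus (size3 (plane X (fst f') (snd f') s' t')) \<noteq> 0"
        proof (rule ccontr)
          assume "\<not> ?thesis"
          then have "excess X = 0" unfolding excess_def by (auto intro!: sum.neutral)
          with e1 show False by simp
        qed
        then obtain v' u' s' t' where F': "(v', u') \<in> set frames" and big: "surplus (size3 (plane X v' u' s' t')) \<noteq> 0"
          by force
        then have six: "6 \<le> size3 (plane X v' u' s' t')" by (auto simp: surplus_def)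
        then have "\<not> slim (plane X v' u' s' t')" using size_bounds(3)[OF H T F', of s' t'] by linarith
        then have "((v', u'), s', t') \<in> fat X" using F' by (simp add: fat_def)
        with inb c1 have "((v', u'), s', t') = ((v, u), s, t)" by (auto simp: card_1_singleton_iff)
        with six have "6 \<le> size3 (plane X v u s t)" by simp
        then have "10 \<le> (\<Sum>t\<in>UNIV. size3 (plane X v u s t))"
          using size_bounds(1)[OF H T F, of s T0] size_bounds(1)[OF H T F, of s T1] size_bounds(1)[OF H T F, of s T2]
          unfolding sum_trit by (cases t) simp_all
        also have "\<dots> = (\<Sum>a\<in>UNIV. rowc X (s \<odot> u + a \<odot> v))" by (rule triple_size[OF F])
        finally have "10 \<le> rowc X (s \<odot> u + T0 \<odot> v) + rowc X (s \<odot> u + T1 \<odot> v) + rowc X (s \<odot> u + T2 \<odot> v)"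
          unfolding sum_trit .
        moreover have "rowc X (s \<odot> u + a \<odot> v) = 2" using c2 i by (simp add: rowc_card)
        moreover have up: "rowc X x \<le> 3 + of_bool (x = i0)" for x
          using others[of x] r4 by (cases "x = i0") (auto simp: rowc_card)
        moreover have "s \<odot> u + b \<odot> v \<noteq> s \<odot> u + c \<odot> v" if "b \<noteq> c" for b c
          using frame_inj[OF F, of s b s c] that by blast
        from this[of T0 T1] this[of T0 T2] this[of T1 T2]
        have "of_bool (s \<odot> u + T0 \<odot> v = i0) + of_bool (s \<odot> u + T1 \<odot> v = i0) + of_bool (s \<odot> u + T2 \<odot> v = i0) \<le> (1::int)"
          unfolding of_bool_def by (auto simp del: smul_simps)
        moreover have "0 \<le> (of_bool p :: int)" for p by simp
        note this[of "s \<odot> u + T0 \<odot> v = i0"] this[of "s \<odot> u + T1 \<odot> v = i0"] this[of "s \<odot> u + T2 \<odot> v = i0"]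
        ultimately show False
          using up[of "s \<odot> u + T0 \<odot> v"] up[of "s \<odot> u + T1 \<odot> v"] up[of "s \<odot> u + T2 \<odot> v"]
          by (cases a; simp only:; linarith)
      qed
      with P have "good_row X i (v, u) s a t" by (simp add: good_row_def f)
      then show "i \<in> ?G" by blast
    qed
    then have "5 \<le> card ?G" using card_mono[of ?G ?A] cardA r4 by (simp add: rowc_card)
    moreover have "card ?G \<le> card (set frames)"
    proof (rule card_inj_image_le[where R = "\<lambda>i f. \<exists>s a t e. pair_row X i f s a t \<and> i0 = s \<odot> snd f + e \<odot> fst f"])
      fix i assume "i \<in> ?G"
      then obtain f s a t where G: "good_row X i f s a t" by blast
      from large[OF this] four obtain e where "i0 = s \<odot> snd f + e \<odot> fst f" by blast
      moreover have "pair_row X i f s a t" "f \<in> set frames" using G by (auto simp: good_row_def pair_row_def)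
      ultimately show "\<exists>f\<in>set frames. \<exists>s a t e. pair_row X i f s a t \<and> i0 = s \<odot> snd f + e \<odot> fst f" by blast
    next
      fix i i' f
      assume "\<exists>s a t e. pair_row X i f s a t \<and> i0 = s \<odot> snd f + e \<odot> fst f"
        "\<exists>s a t e. pair_row X i' f s a t \<and> i0 = s \<odot> snd f + e \<odot> fst f"
      then obtain s a t e s' a' t' e' where *: "pair_row X i f s a t" "pair_row X i' f s' a' t'"
        "s \<odot> snd f + e \<odot> fst f = s' \<odot> snd f + e' \<odot> fst f" by metis
      then have "s = s'" using frame_inj[of "fst f" "snd f"] by (auto simp: pair_row_def)
      with * show "i = i'" using pair_row_unique[OF H] by blast
    qed simp
    ultimately show False by (simp add: card_frames)
  qed
qed

text \<open>Enlarging a set preserves \<open>hit\<close>, so a set of fewer than 23 cells need not be treated separately.\<close>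

theorem hitting_set_size:
  assumes "hit X"
  shows "24 \<le> card {(i, j). X i j}"
proof (rule ccontr)
  assume "\<not> ?thesis"
  then have "card {(i, j). X i j} \<le> 23" by simp
  moreover have "23 \<le> card (UNIV :: (vec \<times> vec) set)"
    using card_vec by (simp add: card_cartesian_product flip: UNIV_Times_UNIV)
  ultimately obtain B where B: "{(i, j). X i j} \<subseteq> B" "card B = 23"
    using exists_subset_between[of "{(i, j). X i j}" 23 UNIV] by auto
  let ?Y = "\<lambda>i j. (i, j) \<in> B"
  have "hit ?Y" using assms B(1) unfolding hit_def by blast
  moreover have "cell_count ?Y = 23"
  proof -
    have "cell_count ?Y = (\<Sum>x\<in>UNIV \<times> UNIV. of_bool (x \<in> B))"
      unfolding cell_count_def rowc_def by (simp add: sum.cartesian_product case_prod_unfold del: sum_of_bool_eq)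
    also have "\<dots> = 23" using B(2) by simp
    finally show ?thesis .
  qed
  ultimately show False using no_hitting_set_of_23 least_class by metis
qed

section \<open>Trades in the Cayley table and the lower bound\<close>

text \<open>Replacing the solutions in \<open>T\<close> by those in \<open>T'\<close> keeps a solution unique.\<close>

lemma ex1_swap:
  assumes ex: "\<exists>!x. P x" and same: "(\<exists>x. T x) \<longleftrightarrow> (\<exists>x. T' x)" and sub: "\<And>x. T x \<Longrightarrow> P x"
    and inj: "\<And>x y. T' x \<Longrightarrow> T' y \<Longrightarrow> x = y"
  shows "\<exists>!x. (P x \<and> \<not> T x) \<or> T' x"
proof (cases "\<exists>x. T x")
  case True
  then obtain x where x: "T' x" using same by blast
  have "\<not> (P y \<and> \<not> T y)" for y using True ex sub by metis
  then show ?thesis using x inj by blast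
next
  case False
  then show ?thesis using ex same by auto
qed

text \<open>If \<open>C\<close> missed \<open>T\<close>, then replacing \<open>T\<close> by \<open>T'\<close>, which fills the same cells and uses the same elements in
  every row and every column, would give a second completion.\<close>

lemma trade_meets:
  assumes U: "uniquely_completable N L C"
    and T: "T \<subseteq> L" "T \<noteq> {}" "T \<inter> T' = {}"
    and cell: "\<And>i j. (\<exists>k. (i, j, k) \<in> T) \<longleftrightarrow> (\<exists>k. (i, j, k) \<in> T')"
    and row: "\<And>i k. (\<exists>j. (i, j, k) \<in> T) \<longleftrightarrow> (\<exists>j. (i, j, k) \<in> T')"
    and col: "\<And>j k. (\<exists>i. (i, j, k) \<in> T) \<longleftrightarrow> (\<exists>i. (i, j, k) \<in> T')"
    and cell1: "\<And>i j k k'. (i, j, k) \<in> T' \<Longrightarrow> (i, j, k') \<in> T' \<Longrightarrow> k = k'"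
    and row1: "\<And>i j j' k. (i, j, k) \<in> T' \<Longrightarrow> (i, j', k) \<in> T' \<Longrightarrow> j = j'"
    and col1: "\<And>i i' j k. (i, j, k) \<in> T' \<Longrightarrow> (i', j, k) \<in> T' \<Longrightarrow> i = i'"
  shows "\<exists>x\<in>T. x \<in> C"
proof (rule ccontr)
  assume no: "\<not> ?thesis"
  let ?M = "(L - T) \<union> T'"
  have CL: "C \<subseteq> L" and uni: "{M. latin_square N M \<and> C \<subseteq> M} = {L}"
    using U by (auto simp: uniquely_completable_def)
  have "L \<in> {M. latin_square N M \<and> C \<subseteq> M}" unfolding uni by (rule singletonI)
  then have L: "latin_square N L" by simp
  note L' = L[unfolded latin_square_def]
  note sub = L'[THEN conjunct1]
    and Lc = L'[THEN conjunct2, THEN conjunct1, rule_format]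
    and Lr = L'[THEN conjunct2, THEN conjunct2, THEN conjunct1, rule_format]
    and Lk = L'[THEN conjunct2, THEN conjunct2, THEN conjunct2, rule_format]
  have in_range: "i < N \<and> j < N \<and> k < N" if t: "(i, j, k) \<in> T'" for i j k
  proof -
    from t cell[of i j] row[of i k] obtain k' j' where "(i, j, k') \<in> T" "(i, j', k) \<in> T" by blast
    then show ?thesis using T(1) sub by blast
  qed
  have "latin_square N ?M"
    unfolding latin_square_def
  proof (intro conjI allI impI)
    have "T' \<subseteq> {..<N} \<times> {..<N} \<times> {..<N}"
      using in_range by (clarify, simp)
    then show "?M \<subseteq> {..<N} \<times> {..<N} \<times> {..<N}" using sub by blast
    fix i j assume b: "i < N" "j < N"
    have "\<exists>!k. ((i, j, k) \<in> L \<and> (i, j, k) \<notin> T) \<or> (i, j, k) \<in> T'"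
      by (rule ex1_swap[OF Lc[OF b] cell]) (use T(1) cell1 in blast)+
    then show "\<exists>!k. (i, j, k) \<in> ?M" by simp
    have "\<exists>!k. ((i, k, j) \<in> L \<and> (i, k, j) \<notin> T) \<or> (i, k, j) \<in> T'"
      by (rule ex1_swap[OF Lr[OF b] row]) (use T(1) row1 in blast)+
    then show "\<exists>!k. (i, k, j) \<in> ?M" by simp
    have "\<exists>!k. ((k, i, j) \<in> L \<and> (k, i, j) \<notin> T) \<or> (k, i, j) \<in> T'"
      by (rule ex1_swap[OF Lk[OF b] col]) (use T(1) col1 in blast)+
    then show "\<exists>!k. (k, i, j) \<in> ?M" by simp
  qed
  moreover have "C \<subseteq> ?M" using CL no by blast
  ultimately have "?M \<in> {M. latin_square N M \<and> C \<subseteq> M}" by blast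
  then have "?M = L" unfolding uni by (rule singletonD)
  moreover obtain x where "x \<in> T" using T(2) by blast
  ultimately show False using T(1,3) by blast
qed

text \<open>Two rows, two columns or two elements whose entries agree on three positions up to a cyclic shift
  can be exchanged there.\<close>

lemma swap_lines_meet:
  assumes U: "uniquely_completable N L C" and d: "distinct [x, y]" "distinct [p, q, r]" "distinct [a, b, c]"
  shows "{(x,p,a), (x,q,b), (x,r,c), (y,p,b), (y,q,c), (y,r,a)} \<subseteq> L \<Longrightarrow>
      \<exists>e\<in>{(x,p,a), (x,q,b), (x,r,c), (y,p,b), (y,q,c), (y,r,a)}. e \<in> C"
    and "{(p,x,a), (q,x,b), (r,x,c), (p,y,b), (q,y,c), (r,y,a)} \<subseteq> L \<Longrightarrow>
      \<exists>e\<in>{(p,x,a), (q,x,b), (r,x,c), (p,y,b), (q,y,c), (r,y,a)}. e \<in> C"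
    and "{(p,a,x), (q,b,x), (r,c,x), (p,b,y), (q,c,y), (r,a,y)} \<subseteq> L \<Longrightarrow>
      \<exists>e\<in>{(p,a,x), (q,b,x), (r,c,x), (p,b,y), (q,c,y), (r,a,y)}. e \<in> C"
proof -
  assume L: "{(x,p,a), (x,q,b), (x,r,c), (y,p,b), (y,q,c), (y,r,a)} \<subseteq> L"
  show "\<exists>e\<in>{(x,p,a), (x,q,b), (x,r,c), (y,p,b), (y,q,c), (y,r,a)}. e \<in> C"
    apply (rule trade_meets[OF U L, where T' = "{(x,p,b), (x,q,c), (x,r,a), (y,p,a), (y,q,b), (y,r,c)}"])
    subgoal by simp
    subgoal using d by simp
    subgoal by (simp add: ex_disj_distrib; argo?)
    subgoal by (simp add: ex_disj_distrib; argo?)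
    subgoal by (simp add: ex_disj_distrib; argo?)
    subgoal using d by (simp; metis)
    subgoal using d by (simp; metis)
    subgoal using d by (simp; metis)
    done
next
  assume L: "{(p,x,a), (q,x,b), (r,x,c), (p,y,b), (q,y,c), (r,y,a)} \<subseteq> L"
  show "\<exists>e\<in>{(p,x,a), (q,x,b), (r,x,c), (p,y,b), (q,y,c), (r,y,a)}. e \<in> C"
    apply (rule trade_meets[OF U L, where T' = "{(p,x,b), (q,x,c), (r,x,a), (p,y,a), (q,y,b), (r,y,c)}"])
    subgoal by simp
    subgoal using d by simp
    subgoal by (simp add: ex_disj_distrib; argo?)
    subgoal by (simp add: ex_disj_distrib; argo?)
    subgoal by (simp add: ex_disj_distrib; argo?)
    subgoal using d by (simp; metis)
    subgoal using d by (simp; metis)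
    subgoal using d by (simp; metis)
    done
next
  assume L: "{(p,a,x), (q,b,x), (r,c,x), (p,b,y), (q,c,y), (r,a,y)} \<subseteq> L"
  show "\<exists>e\<in>{(p,a,x), (q,b,x), (r,c,x), (p,b,y), (q,c,y), (r,a,y)}. e \<in> C"
    apply (rule trade_meets[OF U L, where T' = "{(p,a,y), (q,b,y), (r,c,y), (p,b,x), (q,c,x), (r,a,x)}"])
    subgoal by simp
    subgoal using d by simp
    subgoal by (simp add: ex_disj_distrib; argo?)
    subgoal by (simp add: ex_disj_distrib; argo?)
    subgoal by (simp add: ex_disj_distrib; argo?)
    subgoal using d by (simp; metis)
    subgoal using d by (simp; metis)
    subgoal using d by (simp; metis)
    done
qed

fun tval :: "trit \<Rightarrow> nat" where "tval T0 = 0" | "tval T1 = 1" | "tval T2 = 2"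

definition vval :: "vec \<Rightarrow> nat" where "vval v = 3 * tval (fst v) + tval (snd v)"

lemma tval_less: "tval t < 3" by (cases t) auto
lemma tval_inj: "tval s = tval t \<longleftrightarrow> s = t" by (cases s; cases t) auto
lemma tval_add: "tval (s + t) = (tval s + tval t) mod 3" by (cases s; cases t) (simp_all add: trit_simps)
lemma vval_less: "vval v < 9" using tval_less[of "fst v"] tval_less[of "snd v"] by (simp add: vval_def)
lemma vval_digits: "vval v div 3 = tval (fst v)" "vval v mod 3 = tval (snd v)"
  using tval_less[of "snd v"] by (simp_all add: vval_def)
lemma vval_inj: "vval v = vval w \<longleftrightarrow> v = w"
  by (metis vval_digits tval_inj prod_eqI)

lemma digit_block:
  assumes "r < 9"
  shows "digit3 0 (9 * a + r) = r mod 3" "digit3 (Suc 0) (9 * a + r) = r div 3"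
    "digit3 (Suc (Suc d)) (9 * a + r) = digit3 d a"
proof -
  have e: "9 * a + r = r + 3 * (3 * a)" by simp
  show "digit3 0 (9 * a + r) = r mod 3" unfolding digit3_def e by (simp only: power_0 div_by_1 mod_mult_self2)
  have "(9 * a + r) div 3 = r div 3 + 3 * a" unfolding e by (simp only: div_mult_self2 zero_neq_numeral[symmetric] simp_thms)
  moreover have "r div 3 < 3" using assms by (simp add: less_mult_imp_div_less)
  ultimately show "digit3 (Suc 0) (9 * a + r) = r div 3" by (simp add: digit3_def)
  have "(3::nat) ^ Suc (Suc d) = 9 * 3 ^ d" by simp
  then have "(9 * a + r) div 3 ^ Suc (Suc d) = (9 * a + r) div 9 div 3 ^ d"
    by (simp only: div_mult2_eq)
  then show "digit3 (Suc (Suc d)) (9 * a + r) = digit3 d a"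
    using assms by (simp add: digit3_def)
qed

lemma block_less: "a < 3 ^ m \<Longrightarrow> r < 9 \<Longrightarrow> 9 * a + r < 3 ^ (m + 2)" for a r :: nat
  by (simp add: power_add)

text \<open>Base-3 digits 0 and 1 form the vector in \<open>V\<close>, the higher digits select the block.\<close>

lemma L3_block:
  assumes "(a, b, c) \<in> L3 m"
  shows "(9 * a + vval i, 9 * b + vval j, 9 * c + vval (i + j)) \<in> L3 (m + 2)"
proof -
  have "digit3 d (9 * c + vval (i + j)) = (digit3 d (9 * a + vval i) + digit3 d (9 * b + vval j)) mod 3"
    if d: "d < m + 2" for d
  proof -
    consider "d = 0" | "d = Suc 0" | d' where "d = Suc (Suc d')" by (metis not0_implies_Suc)
    then show ?thesis
      by cases (use assms d in \<open>auto simp: digit_block vval_less vval_digits tval_add L3_def\<close>)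
  qed
  then show ?thesis
    using assms unfolding L3_def by (simp add: block_less vval_less del: add_2_eq_Suc')
qed

lemma digit_sum_ex:
  assumes "a < 3 ^ m" "b < 3 ^ m"
  shows "\<exists>c. (a, b, c) \<in> L3 m"
  using assms
proof (induction m arbitrary: a b)
  case 0
  then show ?case by (auto simp: L3_def)
next
  case (Suc m)
  then have "a div 3 < 3 ^ m" "b div 3 < 3 ^ m" by auto
  then obtain c where c: "(a div 3, b div 3, c) \<in> L3 m" using Suc.IH by blast
  let ?c = "3 * c + (a + b) mod 3"
  have sh: "digit3 (Suc d) x = digit3 d (x div 3)" "digit3 0 x = x mod 3" for d x
    by (simp_all add: digit3_def div_mult2_eq)
  have "digit3 d ?c = (digit3 d a + digit3 d b) mod 3" if "d < Suc m" for d
    using c that by (cases d) (auto simp: sh L3_def mod_add_eq)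
  moreover have "?c < 3 ^ Suc m" using c by (auto simp: L3_def)
  ultimately show ?case using Suc.prems by (intro exI[of _ ?c]) (auto simp: L3_def)
qed

text \<open>The pattern of \<open>C\<close> inside the block with rows \<open>9 * a + r\<close> and columns \<open>9 * b + r\<close>, seen as a set of cells of
  \<open>V \<times> V\<close>. Along a direction \<open>v\<close>, the rows \<open>i\<close> and \<open>i + v\<close> agree up to a shift on three columns.\<close>

lemma block_hit:
  assumes U: "uniquely_completable (3 ^ (m + 2)) (L3 (m + 2)) C" and abc: "(a, b, c) \<in> L3 m"
  shows "hit (\<lambda>i j. (9 * a + vval i, 9 * b + vval j, 9 * c + vval (i + j)) \<in> C)"
  unfolding hit_def
proof (intro allI impI)
  fix v i j :: vec assume v: "v \<noteq> 0"
  have "v \<noteq> - v" using v vec_triple(1)[of v] by (metis add.right_inverse neg_equal_0_iff_equal)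
  then have vv: "x + v \<noteq> x - v" for x
    by (metis add_left_cancel diff_conv_add_uminus)
  have "i + v + (j + v) = i + j + v + v" "i - v + (j - v) = i + j - v - v" by (simp_all add: algebra_simps)
  then have three: "i + v + (j + v) = i + j - v" "i - v + (j - v) = i + j + v" "i + v + (j - v) = i + j" "i - v + (j + v) = i + j"
    by (simp_all only: vec_triple) (simp_all add: algebra_simps)
  have flat: "i + (j + v) = i + j + v" "i + (j - v) = i + j - v" "i + v + j = i + j + v" "i - v + j = i + j - v"
    by (simp_all add: algebra_simps)
  define R where "R x = 9 * a + vval x" for x
  define K where "K x = 9 * b + vval x" for x
  define S where "S x = 9 * c + vval x" for x
  have inj: "R x = R y \<longleftrightarrow> x = y" "K x = K y \<longleftrightarrow> x = y" "S x = S y \<longleftrightarrow> x = y" for x y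
    by (simp_all add: R_def K_def S_def vval_inj)
  have L: "(R x, K y, S (x + y)) \<in> L3 (m + 2)" for x y
    unfolding R_def K_def S_def by (rule L3_block[OF abc])
  note in_L = L[of i j] L[of i "j+v"] L[of i "j-v"] L[of "i+v" j] L[of "i+v" "j+v"] L[of "i+v" "j-v"]
    L[of "i-v" j] L[of "i-v" "j+v"] L[of "i-v" "j-v"]
  have A: "(R i, K j, S (i + j)) \<in> C \<or> (R i, K (j+v), S (i + (j+v))) \<in> C \<or> (R i, K (j-v), S (i + (j-v))) \<in> C \<or>
      (R (i+v), K j, S (i+v + j)) \<in> C \<or> (R (i+v), K (j+v), S (i+v + (j+v))) \<in> C \<or> (R (i+v), K (j-v), S (i+v + (j-v))) \<in> C"
    using swap_lines_meet(1)[OF U, of "R i" "R (i+v)" "K j" "K (j+v)" "K (j-v)" "S (i+j)" "S (i+j+v)" "S (i+j-v)"]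
      in_L unfolding three flat by (simp add: inj v vv vv[symmetric])
  have B: "(R i, K j, S (i + j)) \<in> C \<or> (R (i+v), K j, S (i+v + j)) \<in> C \<or> (R (i-v), K j, S (i-v + j)) \<in> C \<or>
      (R i, K (j+v), S (i + (j+v))) \<in> C \<or> (R (i+v), K (j+v), S (i+v + (j+v))) \<in> C \<or> (R (i-v), K (j+v), S (i-v + (j+v))) \<in> C"
    using swap_lines_meet(2)[OF U, of "K j" "K (j+v)" "R i" "R (i+v)" "R (i-v)" "S (i+j)" "S (i+j+v)" "S (i+j-v)"]
      in_L unfolding three flat by (simp add: inj v vv vv[symmetric])
  have D: "(R i, K j, S (i + j)) \<in> C \<or> (R (i+v), K (j-v), S (i+v + (j-v))) \<in> C \<or> (R (i-v), K (j+v), S (i-v + (j+v))) \<in> C \<or>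
      (R i, K (j+v), S (i + (j+v))) \<in> C \<or> (R (i+v), K j, S (i+v + j)) \<in> C \<or> (R (i-v), K (j-v), S (i-v + (j-v))) \<in> C"
    using swap_lines_meet(3)[OF U, of "S (i+j)" "S (i+j+v)" "R i" "R (i-v)" "R (i+v)" "K j" "K (j+v)" "K (j-v)"]
      in_L unfolding three flat by (simp add: inj v vv vv[symmetric]) blast
  show "((9 * a + vval i, 9 * b + vval j, 9 * c + vval (i + j)) \<in> C \<or> (9 * a + vval i, 9 * b + vval (j+v), 9 * c + vval (i + (j+v))) \<in> C \<or>
      (9 * a + vval i, 9 * b + vval (j-v), 9 * c + vval (i + (j-v))) \<in> C \<or> (9 * a + vval (i+v), 9 * b + vval j, 9 * c + vval (i+v + j)) \<in> C \<or>
      (9 * a + vval (i+v), 9 * b + vval (j+v), 9 * c + vval (i+v + (j+v))) \<in> C \<or> (9 * a + vval (i+v), 9 * b + vval (j-v), 9 * c + vval (i+v + (j-v))) \<in> C) \<and>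
    ((9 * a + vval i, 9 * b + vval j, 9 * c + vval (i + j)) \<in> C \<or> (9 * a + vval (i+v), 9 * b + vval j, 9 * c + vval (i+v + j)) \<in> C \<or>
      (9 * a + vval (i-v), 9 * b + vval j, 9 * c + vval (i-v + j)) \<in> C \<or> (9 * a + vval i, 9 * b + vval (j+v), 9 * c + vval (i + (j+v))) \<in> C \<or>
      (9 * a + vval (i+v), 9 * b + vval (j+v), 9 * c + vval (i+v + (j+v))) \<in> C \<or> (9 * a + vval (i-v), 9 * b + vval (j+v), 9 * c + vval (i-v + (j+v))) \<in> C) \<and>
    ((9 * a + vval i, 9 * b + vval j, 9 * c + vval (i + j)) \<in> C \<or> (9 * a + vval (i+v), 9 * b + vval (j-v), 9 * c + vval (i+v + (j-v))) \<in> C \<or>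
      (9 * a + vval (i-v), 9 * b + vval (j+v), 9 * c + vval (i-v + (j+v))) \<in> C \<or> (9 * a + vval i, 9 * b + vval (j+v), 9 * c + vval (i + (j+v))) \<in> C \<or>
      (9 * a + vval (i+v), 9 * b + vval j, 9 * c + vval (i+v + j)) \<in> C \<or> (9 * a + vval (i-v), 9 * b + vval (j-v), 9 * c + vval (i-v + (j-v))) \<in> C)"
    using A B D unfolding R_def K_def S_def by blast
qed

text \<open>Each of the \<open>3 ^ m * 3 ^ m\<close> blocks contributes at least 24 entries, and the blocks are disjoint.\<close>

lemma uniquely_completable_size:
  assumes U: "uniquely_completable (3 ^ (m + 2)) (L3 (m + 2)) C"
  shows "24 * 9 ^ m \<le> card C"
proof -
  have CL: "C \<subseteq> L3 (m + 2)" using U by (simp add: uniquely_completable_def)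
  have fin: "finite C"
    by (rule finite_subset[of _ "{..<3 ^ (m + 2)} \<times> {..<3 ^ (m + 2)} \<times> {..<3 ^ (m + 2)}"])
      (use CL in \<open>auto simp: L3_def\<close>)
  define c where "c a b = (SOME c. (a, b, c) \<in> L3 m)" for a b
  have c: "(a, b, c a b) \<in> L3 m" if "a < 3 ^ m" "b < 3 ^ m" for a b
    unfolding c_def using digit_sum_ex[OF that] by (rule someI_ex)
  let ?I = "{..<(3::nat) ^ m} \<times> {..<(3::nat) ^ m}"
  let ?e = "\<lambda>((a, b), (i, j)). (9 * a + vval i, 9 * b + vval j, 9 * c a b + vval (i + j))"
  let ?D = "SIGMA x : ?I. {(i, j). ?e (x, (i, j)) \<in> C}"
  have finV: "finite (A :: (vec \<times> vec) set)" for A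
    by (rule finite_subset[of _ UNIV]) simp_all
  have "9 * x + p = 9 * y + q \<longleftrightarrow> x = y \<and> p = q" if "p < 9" "q < 9" for x y p q :: nat
    using that by presburger
  then have blk: "9 * x + vval i = 9 * y + vval j \<longleftrightarrow> x = y \<and> i = j" for x y i j
    by (simp add: vval_less vval_inj)
  have "24 * (9::nat) ^ m = (\<Sum>x\<in>?I. 24 :: nat)"
    by (simp add: card_cartesian_product power_mult_distrib[symmetric])
  also have "\<dots> \<le> (\<Sum>x\<in>?I. card {(i, j). ?e (x, (i, j)) \<in> C})"
  proof (rule sum_mono)
    fix x assume "x \<in> ?I"
    then obtain a b where x: "x = (a, b)" "a < 3 ^ m" "b < 3 ^ m" by auto
    show "24 \<le> card {(i, j). ?e (x, (i, j)) \<in> C}"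
      using hitting_set_size[OF block_hit[OF U c[OF x(2,3)]]] by (simp add: x(1))
  qed
  also have "\<dots> = card ?D" by (rule card_SigmaI[symmetric]) (auto intro: finV)
  also have "\<dots> \<le> card C"
  proof (rule card_inj_on_le[OF _ _ fin])
    show "inj_on ?e ?D" by (auto simp: inj_on_def blk)
    show "?e ` ?D \<subseteq> C" by auto
  qed
  finally show ?thesis .
qed

theorem theorem3:
  fixes n :: nat and C :: "(nat \<times> nat \<times> nat) set"
  assumes "n \<ge> 2"
    and "minimal_size_critical_set (3 ^ n) (L3 n) C"
  shows "card C \<ge> 24 * 9 ^ (n - 2)"
proof -
  from assms(2) have "uniquely_completable (3 ^ n) (L3 n) C"
    by (simp add: minimal_size_critical_set_def critical_set_def)
  moreover have "n = (n - 2) + 2" using assms(1) by simp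
  ultimately show ?thesis using uniquely_completable_size[of "n - 2" C] by simp
qed

end
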